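(* Let $A\in\mathbb{R}^{m\times n}$ and $v,w\in\mathbb{R}^m_{>0}$ be such that $\alpha:=\|V^{-1}(v-w)\|_2\le\frac{1}{10}$ and both $A^TVA$ and $A^TWA$ are invertible, where $V=\mathrm{diag}(v)$, $W=\mathrm{diag}(w)$. For any $\epsilon\in(0,0.5)$ there is a randomized algorithm that outputs a random vector $\hat h\in\mathbb{R}^m$ such that $\mathbb{E}\hat h=\sigma(w)-\sigma(v)$ and, with high probability in $m$, $\|\hat h-(\sigma(w)-\sigma(v))\|_2\le O(\alpha\epsilon)$. Its expected running time is $\tilde O((\mathrm{nnz}(A)+\mathrm{LO})/\epsilon^2)$, where $\mathrm{LO}$ is the time needed to apply $(A^TVA)^{-1}$ and $(A^TWA)^{-1}$ to a vector.
   Context: For $u\in\mathbb{R}^m_{>0}$ with $U=\mathrm{diag}(u)$ and $A^TUA$ invertible, the leverage scores are $\sigma(u)_i=e_i^T\sqrt{U}A(A^TUA)^{-1}A^T\sqrt{U}e_i$ for $i\in[m]$. $\mathrm{nnz}(A)$ is the number of non-zero entries of $A$. *)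

theory Defs
  imports "HOL-Probability.Probability" "Jordan_Normal_Form.Matrix"
begin

no_notation Finite_Cartesian_Product.vec_nth (infixl \<open>$\<close> 90)
no_notation inner (infix \<open>\<bullet>\<close> 70)

section \<open>Linear algebra\<close>

definition matinv :: "real mat \<Rightarrow> real mat" where
  "matinv M = (THE B. inverts_mat M B \<and> inverts_mat B M)"

lemma matinv_inverts:
  assumes "invertible_mat M"
  shows "inverts_mat M (matinv M) \<and> inverts_mat (matinv M) M"
proof -
  obtain B where sq: "dim_row M = dim_col M" and B: "inverts_mat M B" "inverts_mat B M"
    using assms unfolding invertible_mat_def by auto
  have dims: "C \<in> carrier_mat (dim_row M) (dim_row M)"
    if "inverts_mat M C" "inverts_mat C M" for C
  proof -
    have "dim_col (M * C) = dim_row M" "dim_col (C * M) = dim_row C"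
      using that unfolding inverts_mat_def by simp_all
    then show ?thesis using sq by auto
  qed
  have M: "M \<in> carrier_mat (dim_row M) (dim_row M)" using sq by auto
  have uniq: "C = B" if C: "inverts_mat M C" "inverts_mat C M" for C
  proof -
    note cC = dims[OF C] and cB = dims[OF B]
    have "C = C * (M * B)" using B(1) cC unfolding inverts_mat_def by simp
    also have "\<dots> = (C * M) * B" by (rule assoc_mult_mat[OF cC M cB, symmetric])
    also have "\<dots> = B" using C(2) cB cC unfolding inverts_mat_def by simp
    finally show ?thesis .
  qed
  show ?thesis unfolding matinv_def
  proof (rule theI)
    show "inverts_mat M B \<and> inverts_mat B M" using B by blast
    show "C = B" if "inverts_mat M C \<and> inverts_mat C M" for C using uniq that by blast
  qed
qed

definition diag_of_vec :: "real vec \<Rightarrow> real mat" where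
  "diag_of_vec u = mat_diag (dim_vec u) (\<lambda>i. u $ i)"

definition norm2 :: "real vec \<Rightarrow> real" where
  "norm2 x = sqrt (x \<bullet> x)"

definition gram :: "real mat \<Rightarrow> real vec \<Rightarrow> real mat" where
  "gram A u = A\<^sup>T * diag_of_vec u * A"

definition leverage :: "real mat \<Rightarrow> real vec \<Rightarrow> real vec" where
  "leverage A u =
    (let m = dim_vec u; rootU = diag_of_vec (map_vec sqrt u)
     in vec m (\<lambda>i. unit_vec m i \<bullet>
          ((rootU * A * matinv (gram A u) * A\<^sup>T * rootU) *\<^sub>v unit_vec m i)))"

definition nonzeros :: "real mat \<Rightarrow> (nat \<times> nat) set" where
  "nonzeros A = {(i, j). i < dim_row A \<and> j < dim_col A \<and> A $$ (i, j) \<noteq> 0}"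

definition nnz :: "real mat \<Rightarrow> nat" where
  "nnz A = card (nonzeros A)"

section \<open>A randomized real RAM with two linear-operator oracles\<close>

text \<open>
  Programs are finite syntactic objects, so one program has to serve all inputs of all sizes.
  The memory consists of arrays of natural numbers and arrays of reals, each of unbounded length;
  array names are static, indices are computed. Integer arithmetic is addition and truncated
  subtraction, real arithmetic is exact and includes square roots; there is no rounding from
  reals to integers. The only literals are natural numbers.
  Every operation costs one unit, apart from an oracle call, which costs \<open>LO\<close>.
\<close>

datatype iexp =
    INum nat
  | IGet nat iexp
  | IAdd iexp iexp
  | ISub iexp iexp

datatype rexp =
    RNat iexp
  | RGet nat iexp
  | RAdd rexp rexp
  | RSub rexp rexp
  | RMul rexp rexp
  | RDiv rexp rexp
  | RSqrt rexp

datatype bexp =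
    ILess iexp iexp
  | RLess rexp rexp
  | BNot bexp
  | BAnd bexp bexp

datatype solver = InvV | InvW

datatype prog =
    Skip
  | ISet nat iexp iexp
  | RSet nat iexp rexp
  | Toss nat iexp
  | Apply solver nat nat
  | Seq prog prog
  | Cond bexp prog prog
  | Loop bexp prog

text \<open>The component \<open>tossed\<close> is the number of random bits consumed so far.\<close>

record ram =
  imem :: "nat \<Rightarrow> nat \<Rightarrow> nat"
  rmem :: "nat \<Rightarrow> nat \<Rightarrow> real"
  tossed :: nat

fun ieval :: "ram \<Rightarrow> iexp \<Rightarrow> nat" where
  "ieval s (INum k) = k"
| "ieval s (IGet a e) = imem s a (ieval s e)"
| "ieval s (IAdd e f) = ieval s e + ieval s f"
| "ieval s (ISub e f) = ieval s e - ieval s f"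

fun reval :: "ram \<Rightarrow> rexp \<Rightarrow> real" where
  "reval s (RNat e) = real (ieval s e)"
| "reval s (RGet a e) = rmem s a (ieval s e)"
| "reval s (RAdd e f) = reval s e + reval s f"
| "reval s (RSub e f) = reval s e - reval s f"
| "reval s (RMul e f) = reval s e * reval s f"
| "reval s (RDiv e f) = reval s e / reval s f"
| "reval s (RSqrt e) = sqrt (reval s e)"

fun beval :: "ram \<Rightarrow> bexp \<Rightarrow> bool" where
  "beval s (ILess e f) \<longleftrightarrow> ieval s e < ieval s f"
| "beval s (RLess e f) \<longleftrightarrow> reval s e < reval s f"
| "beval s (BNot b) \<longleftrightarrow> \<not> beval s b"
| "beval s (BAnd b c) \<longleftrightarrow> beval s b \<and> beval s c"

fun icost :: "iexp \<Rightarrow> real" where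
  "icost (INum k) = 1"
| "icost (IGet a e) = 1 + icost e"
| "icost (IAdd e f) = 1 + icost e + icost f"
| "icost (ISub e f) = 1 + icost e + icost f"

fun rcost :: "rexp \<Rightarrow> real" where
  "rcost (RNat e) = 1 + icost e"
| "rcost (RGet a e) = 1 + icost e"
| "rcost (RAdd e f) = 1 + rcost e + rcost f"
| "rcost (RSub e f) = 1 + rcost e + rcost f"
| "rcost (RMul e f) = 1 + rcost e + rcost f"
| "rcost (RDiv e f) = 1 + rcost e + rcost f"
| "rcost (RSqrt e) = 1 + rcost e"

fun bcost :: "bexp \<Rightarrow> real" where
  "bcost (ILess e f) = 1 + icost e + icost f"
| "bcost (RLess e f) = 1 + rcost e + rcost f"
| "bcost (BNot b) = 1 + bcost b"
| "bcost (BAnd b c) = 1 + bcost b + bcost c"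

definition iwrite :: "nat \<Rightarrow> nat \<Rightarrow> nat \<Rightarrow> ram \<Rightarrow> ram" where
  "iwrite a i x s = s\<lparr>imem := (imem s)(a := (imem s a)(i := x))\<rparr>"

definition rwrite :: "nat \<Rightarrow> nat \<Rightarrow> real \<Rightarrow> ram \<Rightarrow> ram" where
  "rwrite a i x s = s\<lparr>rmem := (rmem s)(a := (rmem s a)(i := x))\<rparr>"

definition rwrite_vec :: "nat \<Rightarrow> real vec \<Rightarrow> ram \<Rightarrow> ram" where
  "rwrite_vec a x s =
    s\<lparr>rmem := (rmem s)(a := (\<lambda>i. if i < dim_vec x then x $ i else rmem s a i))\<rparr>"

definition rread_vec :: "nat \<Rightarrow> nat \<Rightarrow> ram \<Rightarrow> real vec" where
  "rread_vec k a s = vec k (rmem s a)"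

text \<open>
  \<open>exec S LO \<omega> p s t s'\<close>: with oracle matrices \<open>S\<close>, oracle cost \<open>LO\<close> and random bits \<open>\<omega>\<close>,
  the program \<open>p\<close> started in \<open>s\<close> halts in \<open>s'\<close> after time \<open>t\<close>.
\<close>

inductive exec ::
  "(solver \<Rightarrow> real mat) \<Rightarrow> real \<Rightarrow> (nat \<Rightarrow> bool) \<Rightarrow> prog \<Rightarrow> ram \<Rightarrow> real \<Rightarrow> ram \<Rightarrow> bool"
  for S :: "solver \<Rightarrow> real mat" and LO :: real and \<omega> :: "nat \<Rightarrow> bool"
where
  Skip: "exec S LO \<omega> Skip s 1 s"
| ISet: "exec S LO \<omega> (ISet a e f) s (1 + icost e + icost f) (iwrite a (ieval s e) (ieval s f) s)"
| RSet: "exec S LO \<omega> (RSet a e f) s (1 + icost e + rcost f) (rwrite a (ieval s e) (reval s f) s)"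
| Toss: "exec S LO \<omega> (Toss a e) s (1 + icost e)
          ((iwrite a (ieval s e) (of_bool (\<omega> (tossed s))) s)\<lparr>tossed := Suc (tossed s)\<rparr>)"
| Apply: "exec S LO \<omega> (Apply q a b) s LO
            (rwrite_vec b (S q *\<^sub>v rread_vec (dim_col (S q)) a s) s)"
| Seq: "exec S LO \<omega> p s t s' \<Longrightarrow> exec S LO \<omega> p' s' t' s''
         \<Longrightarrow> exec S LO \<omega> (Seq p p') s (t + t') s''"
| CondT: "beval s b \<Longrightarrow> exec S LO \<omega> p s t s' \<Longrightarrow> exec S LO \<omega> (Cond b p p') s (bcost b + t) s'"
| CondF: "\<not> beval s b \<Longrightarrow> exec S LO \<omega> p' s t s' \<Longrightarrow> exec S LO \<omega> (Cond b p p') s (bcost b + t) s'"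
| LoopF: "\<not> beval s b \<Longrightarrow> exec S LO \<omega> (Loop b p) s (bcost b) s"
| LoopT: "beval s b \<Longrightarrow> exec S LO \<omega> p s t s' \<Longrightarrow> exec S LO \<omega> (Loop b p) s' t' s''
           \<Longrightarrow> exec S LO \<omega> (Loop b p) s (bcost b + t + t') s''"

inductive_cases exec_SkipE: "exec S LO \<omega> Skip s t s'"
inductive_cases exec_ISetE: "exec S LO \<omega> (ISet a e f) s t s'"
inductive_cases exec_RSetE: "exec S LO \<omega> (RSet a e f) s t s'"
inductive_cases exec_TossE: "exec S LO \<omega> (Toss a e) s t s'"
inductive_cases exec_ApplyE: "exec S LO \<omega> (Apply q a b) s t s'"
inductive_cases exec_SeqE: "exec S LO \<omega> (Seq p p') s t s'"
inductive_cases exec_CondE: "exec S LO \<omega> (Cond b p p') s t s'"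
inductive_cases exec_LoopE: "exec S LO \<omega> (Loop b p) s t s'"

lemma exec_deterministic:
  "exec S LO \<omega> p s t s' \<Longrightarrow> exec S LO \<omega> p s u r \<Longrightarrow> u = t \<and> r = s'"
proof (induction arbitrary: u r rule: exec.induct)
  case Skip then show ?case by (elim exec_SkipE) simp
next
  case ISet then show ?case by (elim exec_ISetE) simp
next
  case RSet then show ?case by (elim exec_RSetE) simp
next
  case Toss then show ?case by (elim exec_TossE) simp
next
  case Apply then show ?case by (elim exec_ApplyE) simp
next
  case Seq
  from Seq.prems show ?case by (rule exec_SeqE) (metis Seq.IH)
next
  case CondT
  from CondT.prems show ?case by (rule exec_CondE) (metis CondT.IH CondT.hyps)+
next
  case CondF
  from CondF.prems show ?case by (rule exec_CondE) (metis CondF.IH CondF.hyps)+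
next
  case LoopF
  from LoopF.prems show ?case by (rule exec_LoopE) (use LoopF.hyps in simp_all)
next
  case LoopT
  from LoopT.prems show ?case by (rule exec_LoopE) (metis LoopT.IH LoopT.hyps)+
qed

definition coins :: "(nat \<Rightarrow> bool) measure" where
  "coins = (\<Pi>\<^sub>M _\<in>UNIV. measure_pmf (bernoulli_pmf (1/2)))"

text \<open>
  The matrix is given in coordinate format: \<open>es\<close> lists the positions of its non-zero entries, in an
  arbitrary order. All cells that hold no input are zero. The result is expected in real array 4.
\<close>

definition lists_nonzeros :: "(nat \<times> nat) list \<Rightarrow> real mat \<Rightarrow> bool" where
  "lists_nonzeros es A \<longleftrightarrow> distinct es \<and> set es = nonzeros A"

definition array_of :: "'a::zero list \<Rightarrow> nat \<Rightarrow> 'a" where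
  "array_of xs i = (if i < length xs then xs ! i else 0)"

definition input_state ::
  "real mat \<Rightarrow> (nat \<times> nat) list \<Rightarrow> real vec \<Rightarrow> real vec \<Rightarrow> real \<Rightarrow> ram" where
  "input_state A es v w \<epsilon> =
    \<lparr>imem = (\<lambda>_ _. 0)
       (0 := array_of [dim_row A, dim_col A, length es],
        1 := array_of (map fst es),
        2 := array_of (map snd es)),
     rmem = (\<lambda>_ _. 0)
       (0 := array_of (map (\<lambda>e. A $$ e) es),
        1 := array_of (list_of_vec v),
        2 := array_of (list_of_vec w),
        3 := array_of [\<epsilon>]),
     tossed = 0\<rparr>"

definition oracles :: "real mat \<Rightarrow> real vec \<Rightarrow> real vec \<Rightarrow> solver \<Rightarrow> real mat" where
  "oracles A v w q = (case q of InvV \<Rightarrow> matinv (gram A v) | InvW \<Rightarrow> matinv (gram A w))"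

text \<open>
  On almost every sequence of random bits the program halts, with output \<open>h\<close> after time \<open>T\<close>.
  Since execution is deterministic, \<open>h\<close> and \<open>T\<close> are determined up to a null set.
\<close>

definition produces ::
  "prog \<Rightarrow> real mat \<Rightarrow> (nat \<times> nat) list \<Rightarrow> real vec \<Rightarrow> real vec \<Rightarrow> real \<Rightarrow> real
    \<Rightarrow> ((nat \<Rightarrow> bool) \<Rightarrow> real vec) \<Rightarrow> ((nat \<Rightarrow> bool) \<Rightarrow> real) \<Rightarrow> bool" where
  "produces p A es v w \<epsilon> LO h T \<longleftrightarrow>
    (AE \<omega> in coins. \<exists>s'.
       exec (oracles A v w) LO \<omega> p (input_state A es v w \<epsilon>) (T \<omega>) s' \<and>
       h \<omega> = rread_vec (dim_row A) 4 s')"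

end

theory Submission
  imports Defs
begin

text \<open>
  Let $P = A (A^T V A)^{-1} A^T$, $Q = A (A^T W A)^{-1} A^T$ and $\delta_i = (w_i - v_i) / v_i$.
  Since $P V Q = Q$ and $P W Q = P$, the change $\sigma(w)_i - \sigma(v)_i = w_i Q_{ii} - v_i P_{ii}$ is
  exactly the inner product of $x_i = (v_i \sqrt{v_j} (\delta_i - \delta_j) P_{ij})_j$ and
  $y_i = (\sqrt{v_j} Q_{ij})_j$. For a vector $r$ of random signs $(x_i \cdot r)(y_i \cdot r)$ is therefore an
  unbiased estimate, and all of these numbers are obtained from three solves and a few passes over the
  non-zero entries. The mean of $k = O(\log m / \epsilon^2)$ such products is within
  $\epsilon |x_i| |y_i|$ of its expectation in every row with high probability, by a Chernoff bound.
  Finally $\sum_i |x_i|^2 |y_i|^2 = O(\alpha^2)$: the leverage scores are at most one, hence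
  $v_i |y_i|^2 = O(1)$, while $\sum_i |x_i|^2 / v_i = \sum_{ij} v_i v_j (\delta_i - \delta_j)^2 P_{ij}^2$
  is at most $4 \sum_i \delta_i^2 v_i P_{ii} \le 4 \alpha^2$.
\<close>

section \<open>Expectations over finitely many coins\<close>

text \<open>The error has to be relative to \<alpha>, not to the size of the leverage scores:
  independent estimates of sigma(w) and sigma(v) would leave an error that survives as w tends to v.
  In the inner product above the factor delta_i - delta_j sits inside a vector, so the sketching
  error shrinks with \<alpha>. Both vectors are sketched with the same signs, hence their sketches
  are correlated, and their product is handled as a subexponential variable whose exponential moment
  comes from those of the two squares. Two obstacles shape the program. The time bound has no term
  in m, although zero rows may abound; so signs are drawn at matrix entries. And the machine has
  neither logarithms nor rounding, so the number of sketches is found by counting. That number is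
  not random and all passes have fixed length, so the running time is the same on every coin
  sequence.\<close>

definition depends_on :: "'i set \<Rightarrow> (('i \<Rightarrow> 'b) \<Rightarrow> 'c) \<Rightarrow> bool" where
  "depends_on J f \<longleftrightarrow> (\<forall>\<omega> \<omega>'. (\<forall>j\<in>J. \<omega> j = \<omega>' j) \<longrightarrow> f \<omega> = f \<omega>')"

lemma depends_onI:
  "(\<And>\<omega> \<omega>'. (\<And>j. j \<in> J \<Longrightarrow> \<omega> j = \<omega>' j) \<Longrightarrow> f \<omega> = f \<omega>') \<Longrightarrow> depends_on J f"
  unfolding depends_on_def by blast

lemma depends_onD: "depends_on J f \<Longrightarrow> (\<And>j. j \<in> J \<Longrightarrow> \<omega> j = \<omega>' j) \<Longrightarrow> f \<omega> = f \<omega>'"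
  unfolding depends_on_def by blast

lemma depends_on_mono: "depends_on J f \<Longrightarrow> J \<subseteq> J' \<Longrightarrow> depends_on J' f"
  unfolding depends_on_def by blast

lemma depends_on_comp: "depends_on J f \<Longrightarrow> depends_on J (\<lambda>\<omega>. g (f \<omega>))"
  unfolding depends_on_def by metis

lemma depends_on_comp2:
  "depends_on J f \<Longrightarrow> depends_on J g \<Longrightarrow> depends_on J (\<lambda>\<omega>. k (f \<omega>) (g \<omega>))"
  unfolding depends_on_def by metis

lemma depends_on_sum:
  "(\<And>l. l \<in> L \<Longrightarrow> depends_on J (f l)) \<Longrightarrow> depends_on J (\<lambda>\<omega>. \<Sum>l\<in>L. f l \<omega>)"
  unfolding depends_on_def by (meson sum.cong)

lemma depends_on_fun_upd:
  assumes "depends_on (insert i J) f"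
  shows "depends_on J (\<lambda>\<omega>. f (\<omega> (i := b)))"
  using assms by (intro depends_onI) (auto elim!: depends_onD)

lemma space_coins [simp]: "space coins = UNIV"
  by (simp add: coins_def space_PiM)

lemma prob_space_coins: "prob_space coins"
  unfolding coins_def by (intro prob_space_PiM prob_space_measure_pmf)

interpretation coins: prob_space coins
  by (rule prob_space_coins)

lemma measurable_coin: "(\<lambda>\<omega>. \<omega> i) \<in> measurable coins (count_space UNIV)"
proof -
  have "(\<lambda>\<omega>. \<omega> i) \<in> measurable coins (measure_pmf (bernoulli_pmf (1/2)))"
    unfolding coins_def by (rule measurable_component_singleton) simp
  then show ?thesis by simp
qed

text \<open>A preimage under \<open>f\<close> is a finite union of cylinders, one for each pattern
  \<open>B\<close> of heads within \<open>J\<close>. Later events and expectations thus only need a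
  finite set of relevant coins.\<close>

lemma measurable_depends_on:
  assumes J: "finite J" and f: "depends_on J f"
  shows "f \<in> measurable coins (count_space UNIV)"
proof (rule measurableI)
  fix S :: "'a set"
  let ?\<B> = "{B. B \<subseteq> J \<and> f (\<lambda>j. j \<in> B) \<in> S}"
  have "f -` S = (\<Union>B\<in>?\<B>. {\<omega>. \<forall>j\<in>J. \<omega> j = (j \<in> B)})"
  proof (intro subset_antisym subsetI)
    fix \<omega> assume "\<omega> \<in> f -` S"
    moreover have "f \<omega> = f (\<lambda>j. j \<in> {j\<in>J. \<omega> j})"
      by (rule depends_onD[OF f]) auto
    ultimately show "\<omega> \<in> (\<Union>B\<in>?\<B>. {\<omega>. \<forall>j\<in>J. \<omega> j = (j \<in> B)})"
      by (auto intro!: exI[of _ "{j\<in>J. \<omega> j}"])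
  next
    fix \<omega> assume "\<omega> \<in> (\<Union>B\<in>?\<B>. {\<omega>. \<forall>j\<in>J. \<omega> j = (j \<in> B)})"
    then obtain B where B: "B \<in> ?\<B>" "\<forall>j\<in>J. \<omega> j = (j \<in> B)" by blast
    have "f \<omega> = f (\<lambda>j. j \<in> B)" by (rule depends_onD[OF f]) (use B in auto)
    then show "\<omega> \<in> f -` S" using B by simp
  qed
  moreover have "{\<omega>. \<forall>j\<in>J. \<omega> j = (j \<in> B)} \<in> sets coins" for B
  proof -
    have "{\<omega> \<in> space coins. \<forall>j\<in>J. \<omega> j = (j \<in> B)} \<in> sets coins"
    proof (rule sets.sets_Collect_finite_All[OF _ J])
      fix j
      show "{\<omega> \<in> space coins. \<omega> j = (j \<in> B)} \<in> sets coins"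
        using measurable_sets[OF measurable_coin[of j], of "{j \<in> B}"] by (simp add: vimage_def)
    qed
    then show ?thesis by simp
  qed
  moreover have "finite ?\<B>" using J by simp
  ultimately show "f -` S \<inter> space coins \<in> sets coins" by auto
qed simp

lemma sets_depends_on:
  assumes "finite J" "depends_on J P"
  shows "{\<omega>. P \<omega>} \<in> sets coins"
  using measurable_sets[OF measurable_depends_on[OF assms], of "{True}"] by (simp add: vimage_def)

text \<open>Finitely many coin patterns give finitely many values, so the sum of their absolute
  values bounds \<open>f\<close>.\<close>

lemma integrable_depends_on:
  fixes f :: "(nat \<Rightarrow> bool) \<Rightarrow> real"
  assumes J: "finite J" and f: "depends_on J f"
  shows "integrable coins f"
proof -
  let ?R = "(\<lambda>B. f (\<lambda>j. j \<in> B)) ` Pow J"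
  have "f \<omega> \<in> ?R" for \<omega>
  proof -
    have "f \<omega> = f (\<lambda>j. j \<in> {j\<in>J. \<omega> j})" by (rule depends_onD[OF f]) auto
    then show ?thesis by blast
  qed
  moreover have "finite ?R" using J by simp
  ultimately have "\<bar>f \<omega>\<bar> \<le> (\<Sum>r\<in>?R. \<bar>r\<bar>)" for \<omega>
    by (intro member_le_sum[of "f \<omega>" ?R abs]) auto
  moreover have "f \<in> borel_measurable coins"
    using measurable_compose[OF measurable_depends_on[OF J f], of "\<lambda>x. x" borel] by simp
  ultimately show ?thesis
    by (intro coins.integrable_const_bound[where B = "\<Sum>r\<in>?R. \<bar>r\<bar>"]) auto
qed

text \<open>Overwriting one coordinate of the product measure with a fresh fair coin preserves the
  law. Independence and all exponential moments below are derived from this conditioning on a single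
  coin.\<close>

lemma integral_coins_split:
  fixes f :: "(nat \<Rightarrow> bool) \<Rightarrow> real"
  assumes J: "finite J" and f: "depends_on J f"
  shows "(\<integral>\<omega>. f \<omega> \<partial>coins) =
    ((\<integral>\<omega>. f (\<omega> (i := True)) \<partial>coins) + (\<integral>\<omega>. f (\<omega> (i := False)) \<partial>coins)) / 2"
proof -
  let ?M = "measure_pmf (bernoulli_pmf (1/2))"
  let ?u = "\<lambda>(x, X). X(i := x)"
  interpret M: prob_space ?M by (rule prob_space_measure_pmf)
  interpret pair_sigma_finite ?M coins ..
  have eq: "distr (?M \<Otimes>\<^sub>M coins) coins ?u = coins"
    using distr_pair_PiM_eq_PiM[of UNIV "\<lambda>_. ?M" i, OF prob_space_measure_pmf prob_space_measure_pmf]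
    by (simp add: coins_def)
  have u: "?u \<in> measurable (?M \<Otimes>\<^sub>M coins) coins"
    unfolding coins_def split_beta' by (rule measurable_fun_upd[where J = UNIV]) auto
  have int: "integrable coins f" by (rule integrable_depends_on[OF J f])
  then have int': "integrable (?M \<Otimes>\<^sub>M coins) (\<lambda>p. f (?u p))"
    by (subst integrable_distr_eq[OF u, symmetric]) (auto simp: eq borel_measurable_integrable)
  have "(\<integral>\<omega>. f \<omega> \<partial>coins) = (\<integral>p. f (?u p) \<partial>(?M \<Otimes>\<^sub>M coins))"
    using integral_distr[OF u, of f] int by (simp add: eq borel_measurable_integrable)
  also have "\<dots> = (\<integral>x. (\<integral>X. f (X(i := x)) \<partial>coins) \<partial>?M)"
    using integral_fst'[OF int'] by simp
  also have "\<dots> = ((\<integral>\<omega>. f (\<omega> (i := True)) \<partial>coins) + (\<integral>\<omega>. f (\<omega> (i := False)) \<partial>coins)) / 2"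
    by (subst integral_bernoulli_pmf) (auto simp: field_simps)
  finally show ?thesis .
qed

text \<open>Independence by induction on \<open>J\<close>: both halves of the split on coin
  \<open>i\<close> carry the same factor \<open>g\<close>, because \<open>J'\<close> avoids
  \<open>i\<close>.\<close>

lemma integral_depends_on_mult:
  fixes f g :: "(nat \<Rightarrow> bool) \<Rightarrow> real"
  assumes "finite J" "finite J'" "J \<inter> J' = {}" "depends_on J f" "depends_on J' g"
  shows "(\<integral>\<omega>. f \<omega> * g \<omega> \<partial>coins) = (\<integral>\<omega>. f \<omega> \<partial>coins) * (\<integral>\<omega>. g \<omega> \<partial>coins)"
  using assms(1,3,4)
proof (induction J arbitrary: f rule: finite_induct)
  case empty
  then have "f \<omega> = f undefined" for \<omega> by (auto elim: depends_onD)
  then have "f = (\<lambda>_. f undefined)" by blast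
  then obtain a where "f = (\<lambda>_. a)" by blast
  then show ?case by (simp add: coins.prob_space[unfolded space_coins])
next
  case (insert i J)
  have g: "g (\<omega> (i := b)) = g \<omega>" for \<omega> b
    by (rule depends_onD[OF assms(5)]) (use insert.prems in auto)
  have fg: "depends_on (insert i J \<union> J') (\<lambda>\<omega>. f \<omega> * g \<omega>)"
    by (rule depends_on_comp2[OF depends_on_mono[OF insert.prems(2)] depends_on_mono[OF assms(5)]]) auto
  have "(\<integral>\<omega>. f (\<omega> (i := b)) * g \<omega> \<partial>coins) = (\<integral>\<omega>. f (\<omega> (i := b)) \<partial>coins) * (\<integral>\<omega>. g \<omega> \<partial>coins)" for b
    by (rule insert.IH[OF _ depends_on_fun_upd[OF insert.prems(2)]]) (use insert.prems in auto)
  moreover have "finite (insert i J \<union> J')" "finite (insert i J)" using insert.hyps assms(2) by auto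
  ultimately show ?case
    unfolding integral_coins_split[OF \<open>finite (insert i J \<union> J')\<close> fg, of i] g
      integral_coins_split[OF \<open>finite (insert i J)\<close> insert.prems(2), of i]
    by (simp add: algebra_simps)
qed

section \<open>Rademacher sums\<close>

definition coin_sign :: "bool \<Rightarrow> real" where
  "coin_sign b = (if b then 1 else -1)"

lemma coin_sign_simps [simp]: "coin_sign True = 1" "coin_sign False = -1"
  by (simp_all add: coin_sign_def)

lemma coin_sign_mult_self [simp]: "coin_sign b * coin_sign b = 1"
  by (simp add: coin_sign_def)

lemma depends_on_coin_sum:
  "depends_on (g ` J) (\<lambda>\<omega>. \<Sum>j\<in>J. x j * coin_sign (\<omega> (g j)))"
  by (rule depends_onI) (auto intro!: sum.cong)

lemma integral_coin_sign: "(\<integral>\<omega>. coin_sign (\<omega> i) \<partial>coins) = 0"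
proof -
  have "depends_on {i} (\<lambda>\<omega>. coin_sign (\<omega> i))" by (intro depends_onI) auto
  from integral_coins_split[OF _ this, of i] show ?thesis
    by (simp add: coins.prob_space[unfolded space_coins])
qed

lemma integral_coin_sign_mult:
  "(\<integral>\<omega>. coin_sign (\<omega> i) * coin_sign (\<omega> j) \<partial>coins) = of_bool (i = j)"
proof (cases "i = j")
  case True
  then show ?thesis by (simp add: coins.prob_space[unfolded space_coins])
next
  case False
  have "(\<integral>\<omega>. coin_sign (\<omega> i) * coin_sign (\<omega> j) \<partial>coins) =
      (\<integral>\<omega>. coin_sign (\<omega> i) \<partial>coins) * (\<integral>\<omega>. coin_sign (\<omega> j) \<partial>coins)"
    using False
    by (intro integral_depends_on_mult[of "{i}" "{j}"]) (auto intro!: depends_onI)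
  then show ?thesis using False by (simp add: integral_coin_sign)
qed

text \<open>Only the diagonal of the expanded product survives, since distinct signs are
  uncorrelated. This is the unbiasedness of one sketch.\<close>

lemma integral_coin_sum_mult:
  fixes x y :: "'a \<Rightarrow> real" and g :: "'a \<Rightarrow> nat"
  assumes J: "finite J" and inj: "inj_on g J"
  shows "(\<integral>\<omega>. (\<Sum>j\<in>J. x j * coin_sign (\<omega> (g j))) * (\<Sum>j\<in>J. y j * coin_sign (\<omega> (g j))) \<partial>coins)
    = (\<Sum>j\<in>J. x j * y j)"
proof -
  have int: "integrable coins (\<lambda>\<omega>. x i * y j * (coin_sign (\<omega> (g i)) * coin_sign (\<omega> (g j))))" for i j
    by (rule integrable_depends_on[of "{g i, g j}"]) (auto intro!: depends_onI)
  have "(\<integral>\<omega>. (\<Sum>j\<in>J. x j * coin_sign (\<omega> (g j))) * (\<Sum>j\<in>J. y j * coin_sign (\<omega> (g j))) \<partial>coins) =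
    (\<integral>\<omega>. (\<Sum>i\<in>J. \<Sum>j\<in>J. x i * y j * (coin_sign (\<omega> (g i)) * coin_sign (\<omega> (g j)))) \<partial>coins)"
    by (simp add: sum_product mult_ac)
  also have "\<dots> = (\<Sum>i\<in>J. \<Sum>j\<in>J. x i * y j * of_bool (g i = g j))"
    by (simp only: Bochner_Integration.integral_sum Bochner_Integration.integrable_sum int
        integral_mult_right_zero integral_coin_sign_mult)
  also have "\<dots> = (\<Sum>i\<in>J. \<Sum>j\<in>J. if i = j then x i * y i else 0)"
    using inj by (intro sum.cong) (auto simp: inj_on_eq_iff)
  also have "\<dots> = (\<Sum>j\<in>J. x j * y j)" using J by simp
  finally show ?thesis .
qed

text \<open>Square root of exp z <= 1 / (1 - z), which follows from 1 - z <= exp (- z).\<close>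

lemma exp_half_le: "exp (z / 2) \<le> 1 / sqrt (1 - z)" if "0 \<le> z" "z < 1" for z :: real
proof -
  have "(1 - z) * exp z \<le> exp (- z) * exp z"
    using exp_ge_add_one_self[of "-z"] by (intro mult_right_mono) auto
  then have "exp z \<le> 1 / (1 - z)" using that by (simp add: field_simps flip: exp_add)
  then have "sqrt (exp z) \<le> sqrt (1 / (1 - z))" by simp
  moreover have "sqrt (exp z) = exp (z / 2)"
    by (rule real_sqrt_unique) (auto simp: power2_eq_square simp flip: exp_add)
  ultimately show ?thesis by (simp add: real_sqrt_divide)
qed

text \<open>Hoeffding's lemma for a fair sign, from its logarithmic form with range 2 y and p = 1/2;
  evenness covers negative \<open>y\<close>.\<close>

lemma cosh_le_exp_half_square: "(exp y + exp (- y)) / 2 \<le> exp (y\<^sup>2 / 2)" for y :: real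
proof -
  have *: "(exp y + exp (- y)) / 2 \<le> exp (y\<^sup>2 / 2)" if y: "0 \<le> y" for y :: real
  proof -
    have "- (2 * y) * (1/2) + ln (1 + 1/2 * (exp (2 * y) - 1)) \<le> (2 * y)\<^sup>2 / 8"
      using Hoeffdings_lemma_aux[of "2 * y" "1/2"] y by simp
    then have "exp (- y + ln ((1 + exp (2 * y)) / 2)) \<le> exp (y\<^sup>2 / 2)"
      by (simp add: field_simps power2_eq_square)
    moreover have "exp (- y + ln ((1 + exp (2 * y)) / 2)) = exp (- y) * ((1 + exp (2 * y)) / 2)"
      by (subst exp_add, subst exp_ln) (auto simp: add_pos_pos)
    moreover have "\<dots> = (exp y + exp (- y)) / 2"
      by (simp add: distrib_left flip: exp_add)
    ultimately show ?thesis by (simp only:)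
  qed
  show ?thesis using *[of y] *[of "- y"] by (cases "0 \<le> y") (auto simp: add.commute)
qed

text \<open>
  Equality holds when the signed sum is replaced by a centred Gaussian of the same variance; the
  induction step says that a Gaussian of variance $b^2$ dominates a random sign of size $b$.
\<close>

lemma integral_exp_square_coin_sum:
  fixes x :: "'a \<Rightarrow> real" and g :: "'a \<Rightarrow> nat"
  assumes "finite J" "inj_on g J" "0 \<le> s" "2 * s * (\<Sum>j\<in>J. (x j)\<^sup>2) < 1"
  shows "(\<integral>\<omega>. exp (s * (a + (\<Sum>j\<in>J. x j * coin_sign (\<omega> (g j))))\<^sup>2) \<partial>coins)
    \<le> exp (s * a\<^sup>2 / (1 - 2 * s * (\<Sum>j\<in>J. (x j)\<^sup>2))) / sqrt (1 - 2 * s * (\<Sum>j\<in>J. (x j)\<^sup>2))"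
  using assms
proof (induction J arbitrary: a rule: finite_induct)
  case empty
  then show ?case by (simp add: coins.prob_space[unfolded space_coins])
next
  case (insert i J)
  define T where "T = (\<Sum>j\<in>J. (x j)\<^sup>2)"
  define b where "b = x i"
  \<comment> \<open>\<open>s'\<close> is the exponent that the induction hypothesis yields after
    averaging over \<open>J\<close>. Below, \<open>z\<close> is the share of the new coordinate,
    scaled so that (1 - 2sT)(1 - z) = 1 - 2s(T + b^2).\<close>
  define s' where "s' = s / (1 - 2 * s * T)"
  have "2 * s * T + 2 * s * b\<^sup>2 < 1"
    using insert by (simp add: T_def b_def algebra_simps)
  moreover have "0 \<le> s * b\<^sup>2" using insert.prems by simp
  ultimately have T: "2 * s * T < 1" by linarith
  have s': "0 \<le> s'" using T insert.prems by (simp add: s'_def)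
  define z where "z = 2 * s' * b\<^sup>2"
  have z: "0 \<le> z" "z < 1" and z1: "(1 - 2 * s * T) * (1 - z) = 1 - 2 * s * (T + b\<^sup>2)"
  proof -
    have "z = 2 * s * b\<^sup>2 / (1 - 2 * s * T)" by (simp add: z_def s'_def)
    then show "z < 1" "(1 - 2 * s * T) * (1 - z) = 1 - 2 * s * (T + b\<^sup>2)"
      using T \<open>2 * s * T + 2 * s * b\<^sup>2 < 1\<close> by (simp_all add: right_diff_distrib distrib_left)
  qed (use s' in \<open>simp add: z_def\<close>)
  let ?f = "\<lambda>a \<omega>. exp (s * (a + (\<Sum>j\<in>J. x j * coin_sign (\<omega> (g j))))\<^sup>2)"
  let ?F = "\<lambda>\<omega>. exp (s * (a + (\<Sum>j\<in>insert i J. x j * coin_sign (\<omega> (g j))))\<^sup>2)"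
  have dep: "depends_on (g ` insert i J) ?F"
    by (rule depends_on_comp[OF depends_on_coin_sum])
  have upd: "?F (\<omega> (g i := c)) = ?f (a + b * coin_sign c) \<omega>" for \<omega> c
  proof -
    have "(\<Sum>j\<in>J. x j * coin_sign ((\<omega> (g i := c)) (g j))) = (\<Sum>j\<in>J. x j * coin_sign (\<omega> (g j)))"
      using insert by (intro sum.cong) (auto simp: inj_on_def)
    then show ?thesis using insert.hyps by (simp add: b_def algebra_simps)
  qed
  have IH: "(\<integral>\<omega>. ?f c \<omega> \<partial>coins) \<le> exp (s' * c\<^sup>2) / sqrt (1 - 2 * s * T)" for c
    using insert.IH[of c] insert.prems T by (simp add: T_def s'_def)
  have "(\<integral>\<omega>. ?F \<omega> \<partial>coins) = ((\<integral>\<omega>. ?f (a + b) \<omega> \<partial>coins) + (\<integral>\<omega>. ?f (a - b) \<omega> \<partial>coins)) / 2"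
    using integral_coins_split[OF _ dep, of "g i"] insert.hyps unfolding upd by simp
  also have "\<dots> \<le> ((exp (s' * (a + b)\<^sup>2) + exp (s' * (a - b)\<^sup>2)) / 2) / sqrt (1 - 2 * s * T)"
    using IH[of "a + b"] IH[of "a - b"] by (simp add: add_divide_distrib)
  also have "(exp (s' * (a + b)\<^sup>2) + exp (s' * (a - b)\<^sup>2)) / 2 =
      exp (s' * (a\<^sup>2 + b\<^sup>2)) * ((exp (2 * s' * a * b) + exp (- (2 * s' * a * b))) / 2)"
  proof -
    have "s' * (a + b)\<^sup>2 = s' * (a\<^sup>2 + b\<^sup>2) + 2 * s' * a * b"
      "s' * (a - b)\<^sup>2 = s' * (a\<^sup>2 + b\<^sup>2) + - (2 * s' * a * b)"
      by (simp_all add: power2_eq_square algebra_simps)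
    then show ?thesis by (simp only: exp_add distrib_left add_divide_distrib times_divide_eq_right)
  qed
  also have "\<dots> \<le> exp (s' * (a\<^sup>2 + b\<^sup>2)) * exp ((2 * s' * a * b)\<^sup>2 / 2)"
    by (intro mult_left_mono cosh_le_exp_half_square) auto
  also have "\<dots> = exp (s' * a\<^sup>2 * (1 + z)) * exp (z / 2)"
  proof -
    have "s' * (a\<^sup>2 + b\<^sup>2) + (2 * s' * a * b)\<^sup>2 / 2 = s' * a\<^sup>2 * (1 + z) + z / 2"
      by (simp add: z_def power2_eq_square algebra_simps)
    then show ?thesis by (simp only: exp_add[symmetric])
  qed
  \<comment> \<open>Both factors move to their Gaussian values: 1 + z <= 1 / (1 - z) in the
    exponent, exp (z / 2) <= 1 / sqrt (1 - z) in front.\<close>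
  also have "\<dots> \<le> exp (s' * a\<^sup>2 * (1 / (1 - z))) * (1 / sqrt (1 - z))"
  proof (intro mult_mono exp_half_le z)
    have "(1 + z) * (1 - z) \<le> 1" by (simp add: algebra_simps)
    then have "1 + z \<le> 1 / (1 - z)" using z by (simp add: pos_le_divide_eq)
    then show "exp (s' * a\<^sup>2 * (1 + z)) \<le> exp (s' * a\<^sup>2 * (1 / (1 - z)))"
      using s' by (simp only: exp_le_cancel_iff) (intro mult_left_mono, auto)
  qed auto
  also have "exp (s' * a\<^sup>2 * (1 / (1 - z))) * (1 / sqrt (1 - z)) / sqrt (1 - 2 * s * T) =
      exp (s * a\<^sup>2 / (1 - 2 * s * (T + b\<^sup>2))) / sqrt (1 - 2 * s * (T + b\<^sup>2))"
  proof -
    have "s' * a\<^sup>2 * (1 / (1 - z)) = s * a\<^sup>2 / ((1 - 2 * s * T) * (1 - z))"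
      by (simp add: s'_def)
    moreover have "sqrt (1 - z) * sqrt (1 - 2 * s * T) = sqrt (1 - 2 * s * (T + b\<^sup>2))"
      unfolding z1[symmetric] by (simp add: real_sqrt_mult mult.commute)
    ultimately show ?thesis by (simp add: z1)
  qed
  finally have "(\<integral>\<omega>. ?F \<omega> \<partial>coins) \<le>
      exp (s * a\<^sup>2 / (1 - 2 * s * (T + b\<^sup>2))) / sqrt (1 - 2 * s * (T + b\<^sup>2))"
    using T by (simp add: divide_right_mono)
  moreover have "(\<Sum>j\<in>insert i J. (x j)\<^sup>2) = T + b\<^sup>2"
    using insert.hyps by (simp add: T_def b_def)
  ultimately show ?case by (simp only:)
qed

text \<open>Taylor expansion to order two. The z^2 of the remainder is absorbed by exp (|z| / 8),
  since (|z| / 8)^2 / 2 <= exp (|z| / 8); together with the 1/8 allowed to |t| the exponent becomes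
  |z| / 4, for which products of sketches have a bounded moment.\<close>

lemma exp_le_quadratic:
  fixes t z :: real
  assumes t: "\<bar>t\<bar> \<le> 1/8"
  shows "exp (t * z) \<le> 1 + t * z + 64 * t\<^sup>2 * exp (\<bar>z\<bar> / 4)"
proof -
  obtain u where u: "\<bar>u\<bar> \<le> \<bar>t * z\<bar>"
    and eq: "exp (t * z) = (\<Sum>m<2. (t * z) ^ m / fact m) + exp u / fact 2 * (t * z) ^ 2"
    using Maclaurin_exp_le[of "t * z" 2] by blast
  have "\<bar>t\<bar> * \<bar>z\<bar> \<le> 1/8 * \<bar>z\<bar>" by (rule mult_right_mono[OF t]) simp
  then have u8: "u \<le> \<bar>z\<bar> / 8" using u by (simp add: abs_mult)
  have "(\<bar>z\<bar> / 8)\<^sup>2 / 2 \<le> exp (\<bar>z\<bar> / 8)"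
    using exp_lower_Taylor_quadratic[of "\<bar>z\<bar> / 8"] by simp
  then have z2: "z\<^sup>2 \<le> 128 * exp (\<bar>z\<bar> / 8)" by (simp add: power_divide)
  have "exp u * z\<^sup>2 \<le> exp (\<bar>z\<bar> / 8) * (128 * exp (\<bar>z\<bar> / 8))"
    using u8 z2 by (intro mult_mono) auto
  also have "\<dots> = 128 * exp (\<bar>z\<bar> / 4)" by (simp flip: exp_add)
  finally have "t\<^sup>2 * (exp u * z\<^sup>2) \<le> t\<^sup>2 * (128 * exp (\<bar>z\<bar> / 4))"
    by (rule mult_left_mono) simp
  then show ?thesis unfolding eq by (simp add: numeral_2_eq_2 power_mult_distrib algebra_simps)
qed

lemma sum_mult_le_one:
  fixes x y :: "'a \<Rightarrow> real"
  assumes "(\<Sum>j\<in>J. (x j)\<^sup>2) = 1" "(\<Sum>j\<in>J. (y j)\<^sup>2) = 1"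
  shows "\<bar>\<Sum>j\<in>J. x j * y j\<bar> \<le> 1"
proof -
  have "(\<Sum>j\<in>J. x j * y j)\<^sup>2 \<le> (\<Sum>j\<in>J. (x j)\<^sup>2) * (\<Sum>j\<in>J. (y j)\<^sup>2)"
    by (rule Cauchy_Schwarz_ineq_sum)
  then show ?thesis using assms by (simp add: abs_square_le_1)
qed

section \<open>Rademacher sketches: unbiased products and their concentration\<close>

locale rademacher_sketches =
  fixes J :: "'a set" and g :: "nat \<Rightarrow> 'a \<Rightarrow> nat" and k :: nat
  assumes finite_J: "finite J"
    and inj_g: "\<And>l. l < k \<Longrightarrow> inj_on (g l) J"
    and disjoint_g: "\<And>l l'. l < k \<Longrightarrow> l' < l \<Longrightarrow> g l ` J \<inter> g l' ` J = {}"
begin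

text \<open>Coin \<open>g l j\<close> supplies the sign of coordinate \<open>j\<close> in sketch
  \<open>l\<close>. The indexing stays abstract because the program draws one coin per matrix entry
  and keeps only one per row; disjoint images for different \<open>l\<close> make the sketches
  independent.\<close>

definition sketch :: "('a \<Rightarrow> real) \<Rightarrow> nat \<Rightarrow> (nat \<Rightarrow> bool) \<Rightarrow> real" where
  "sketch x l \<omega> = (\<Sum>j\<in>J. x j * coin_sign (\<omega> (g l j)))"

definition sketch_prod :: "('a \<Rightarrow> real) \<Rightarrow> ('a \<Rightarrow> real) \<Rightarrow> (nat \<Rightarrow> bool) \<Rightarrow> real" where
  "sketch_prod x y \<omega> = (\<Sum>l<k. sketch x l \<omega> * sketch y l \<omega>) / real k"

lemma depends_on_sketch: "depends_on (g l ` J) (sketch x l)"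
  unfolding sketch_def[abs_def] by (rule depends_on_coin_sum)

lemma depends_on_sketch_mult: "depends_on (g l ` J) (\<lambda>\<omega>. f (sketch x l \<omega>) (sketch y l \<omega>))"
  by (rule depends_on_comp2[OF depends_on_sketch depends_on_sketch])

lemma depends_on_sketch_sum:
  "depends_on (\<Union>l<n. g l ` J) (\<lambda>\<omega>. \<Sum>l<n. f (sketch x l \<omega>) (sketch y l \<omega>))"
  by (rule depends_on_sum, rule depends_on_mono[OF depends_on_sketch_mult]) auto

lemma depends_on_sketch_prod: "depends_on (\<Union>l<k. g l ` J) (sketch_prod x y)"
  unfolding sketch_prod_def[abs_def] by (rule depends_on_comp[OF depends_on_sketch_sum])

lemma finite_coins: "finite (\<Union>l<n. g l ` J)"
  using finite_J by simp

lemma integrable_sketch_prod: "integrable coins (sketch_prod x y)"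
  by (rule integrable_depends_on[OF finite_coins depends_on_sketch_prod])

lemma integral_sketch_prod:
  assumes "0 < k"
  shows "(\<integral>\<omega>. sketch_prod x y \<omega> \<partial>coins) = (\<Sum>j\<in>J. x j * y j)"
proof -
  have "(\<integral>\<omega>. sketch x l \<omega> * sketch y l \<omega> \<partial>coins) = (\<Sum>j\<in>J. x j * y j)" if "l < k" for l
    unfolding sketch_def by (rule integral_coin_sum_mult[OF finite_J inj_g[OF that]])
  moreover have "integrable coins (\<lambda>\<omega>. sketch x l \<omega> * sketch y l \<omega>)" for l
    by (rule integrable_depends_on[OF finite_imageI[OF finite_J] depends_on_sketch_mult])
  ultimately have "(\<integral>\<omega>. (\<Sum>l<k. sketch x l \<omega> * sketch y l \<omega>) \<partial>coins) = real k * (\<Sum>j\<in>J. x j * y j)"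
    by (subst Bochner_Integration.integral_sum) auto
  then show ?thesis using assms by (simp add: sketch_prod_def)
qed

lemma integral_exp_sketch_square:
  assumes "l < k" "(\<Sum>j\<in>J. (x j)\<^sup>2) = 1"
  shows "(\<integral>\<omega>. exp ((sketch x l \<omega>)\<^sup>2 / 4) \<partial>coins) \<le> sqrt 2"
  using integral_exp_square_coin_sum[OF finite_J inj_g[OF assms(1)], of "1/4" x 0] assms(2)
  by (simp add: sketch_def real_sqrt_divide)

text \<open>The two sketches share their signs, so independence cannot be used. Instead |XY| <= (X^2
  + Y^2) / 2 and the AM-GM inequality for exponentials reduce the product to the moments of the two
  squares. Centring costs a factor exp (1/4), as the mean lies in [-1, 1].\<close>

lemma integral_exp_abs_sketch_mult:
  assumes l: "l < k" and x: "(\<Sum>j\<in>J. (x j)\<^sup>2) = 1" and y: "(\<Sum>j\<in>J. (y j)\<^sup>2) = 1"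
  shows "(\<integral>\<omega>. exp (\<bar>sketch x l \<omega> * sketch y l \<omega> - (\<Sum>j\<in>J. x j * y j)\<bar> / 4) \<partial>coins) \<le> 2"
proof -
  let ?X = "sketch x l" and ?Y = "sketch y l" and ?c = "\<Sum>j\<in>J. x j * y j"
  have int: "integrable coins (\<lambda>\<omega>. f (?X \<omega>) (?Y \<omega>))" for f :: "real \<Rightarrow> real \<Rightarrow> real"
    by (rule integrable_depends_on[OF finite_imageI[OF finite_J] depends_on_sketch_mult])
  have "exp (\<bar>?X \<omega> * ?Y \<omega> - ?c\<bar> / 4)
      \<le> exp (1/4) * ((exp ((?X \<omega>)\<^sup>2 / 4) + exp ((?Y \<omega>)\<^sup>2 / 4)) / 2)" for \<omega>
  proof -
    define a where "a = (?X \<omega>)\<^sup>2 / 4"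
    define b where "b = (?Y \<omega>)\<^sup>2 / 4"
    have "0 \<le> (\<bar>?X \<omega>\<bar> - \<bar>?Y \<omega>\<bar>)\<^sup>2" by simp
    then have "\<bar>?X \<omega> * ?Y \<omega>\<bar> \<le> ((?X \<omega>)\<^sup>2 + (?Y \<omega>)\<^sup>2) / 2"
      by (simp add: power2_eq_square algebra_simps abs_mult)
    then have "\<bar>?X \<omega> * ?Y \<omega> - ?c\<bar> / 4 \<le> 1/4 + (a / 2 + b / 2)"
      using sum_mult_le_one[OF x y] by (simp add: a_def b_def)
    then have "exp (\<bar>?X \<omega> * ?Y \<omega> - ?c\<bar> / 4) \<le> exp (1/4) * (exp (a / 2) * exp (b / 2))"
      by (simp flip: exp_add)
    also have "exp (a / 2) * exp (b / 2) \<le> (exp a + exp b) / 2"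
    proof -
      have "0 \<le> (exp (a / 2) - exp (b / 2))\<^sup>2" by simp
      then show ?thesis by (simp add: power2_eq_square algebra_simps flip: exp_add)
    qed
    finally show ?thesis by (simp add: a_def b_def)
  qed
  then have "(\<integral>\<omega>. exp (\<bar>?X \<omega> * ?Y \<omega> - ?c\<bar> / 4) \<partial>coins) \<le>
      (\<integral>\<omega>. exp (1/4) * ((exp ((?X \<omega>)\<^sup>2 / 4) + exp ((?Y \<omega>)\<^sup>2 / 4)) / 2) \<partial>coins)"
    by (intro integral_mono int[of "\<lambda>a b. exp (\<bar>a * b - ?c\<bar> / 4)"]
        int[of "\<lambda>a b. exp (1/4) * ((exp (a\<^sup>2 / 4) + exp (b\<^sup>2 / 4)) / 2)"])
  also have "\<dots> = exp (1/4) * (((\<integral>\<omega>. exp ((?X \<omega>)\<^sup>2 / 4) \<partial>coins) + (\<integral>\<omega>. exp ((?Y \<omega>)\<^sup>2 / 4) \<partial>coins)) / 2)"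
    using int[of "\<lambda>a b. exp (a\<^sup>2 / 4)"] int[of "\<lambda>a b. exp (b\<^sup>2 / 4)"] by simp
  \<comment> \<open>One sqrt 2 bounds exp (1/4), by \<open>exp_half_le\<close> at 1/2; the other
    bounds the average of the two moments.\<close>
  also have "\<dots> \<le> sqrt 2 * sqrt 2"
    using exp_half_le[of "1/2"] integral_exp_sketch_square[OF l x] integral_exp_sketch_square[OF l y]
    by (intro mult_mono) (auto simp: real_sqrt_divide)
  finally show ?thesis by simp
qed

text \<open>The linear term of the quadratic bound vanishes because the variable is centred; 128 is
  64 times the moment bound 2.\<close>

lemma integral_exp_sketch_mult:
  assumes l: "l < k" and x: "(\<Sum>j\<in>J. (x j)\<^sup>2) = 1" and y: "(\<Sum>j\<in>J. (y j)\<^sup>2) = 1"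
    and t: "\<bar>t\<bar> \<le> 1/8"
  shows "(\<integral>\<omega>. exp (t * (sketch x l \<omega> * sketch y l \<omega> - (\<Sum>j\<in>J. x j * y j))) \<partial>coins) \<le> exp (128 * t\<^sup>2)"
proof -
  let ?c = "\<Sum>j\<in>J. x j * y j"
  let ?Z = "\<lambda>\<omega>. sketch x l \<omega> * sketch y l \<omega> - ?c"
  have int: "integrable coins (\<lambda>\<omega>. f (?Z \<omega>))" for f :: "real \<Rightarrow> real"
    by (rule integrable_depends_on[OF finite_imageI[OF finite_J]
          depends_on_sketch_mult[of l "\<lambda>a b. f (a * b - ?c)"]])
  have "(\<integral>\<omega>. sketch x l \<omega> * sketch y l \<omega> \<partial>coins) = ?c"
    unfolding sketch_def by (rule integral_coin_sum_mult[OF finite_J inj_g[OF l]])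
  moreover have "integrable coins (\<lambda>\<omega>. sketch x l \<omega> * sketch y l \<omega>)"
    by (rule integrable_depends_on[OF finite_imageI[OF finite_J] depends_on_sketch_mult])
  ultimately have mean: "(\<integral>\<omega>. ?Z \<omega> \<partial>coins) = 0"
    by (simp add: coins.prob_space[unfolded space_coins])
  have "(\<integral>\<omega>. exp (t * ?Z \<omega>) \<partial>coins) \<le> (\<integral>\<omega>. 1 + t * ?Z \<omega> + 64 * t\<^sup>2 * exp (\<bar>?Z \<omega>\<bar> / 4) \<partial>coins)"
    by (intro integral_mono int[of "\<lambda>z. exp (t * z)"]
        int[of "\<lambda>z. 1 + t * z + 64 * t\<^sup>2 * exp (\<bar>z\<bar> / 4)"] exp_le_quadratic t)
  also have "\<dots> = 1 + t * (\<integral>\<omega>. ?Z \<omega> \<partial>coins) + 64 * t\<^sup>2 * (\<integral>\<omega>. exp (\<bar>?Z \<omega>\<bar> / 4) \<partial>coins)"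
    using int[of "\<lambda>z. t * z"] int[of "\<lambda>z. 64 * t\<^sup>2 * exp (\<bar>z\<bar> / 4)"]
    by (simp add: coins.prob_space[unfolded space_coins] del: Bochner_Integration.integral_diff)
  also have "\<dots> \<le> 1 + 64 * t\<^sup>2 * 2"
    using mult_left_mono[OF integral_exp_abs_sketch_mult[OF l x y], of "64 * t\<^sup>2"] by (simp add: mean)
  also have "\<dots> \<le> exp (128 * t\<^sup>2)" using exp_ge_add_one_self[of "128 * t\<^sup>2"] by simp
  finally show ?thesis .
qed

text \<open>Sketch \<open>n\<close> reads coins disjoint from those of the earlier ones, so the
  moments multiply.\<close>

lemma integral_exp_sketch_sum:
  assumes x: "(\<Sum>j\<in>J. (x j)\<^sup>2) = 1" and y: "(\<Sum>j\<in>J. (y j)\<^sup>2) = 1" and t: "\<bar>t\<bar> \<le> 1/8"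
  shows "n \<le> k \<Longrightarrow>
    (\<integral>\<omega>. exp (t * (\<Sum>l<n. sketch x l \<omega> * sketch y l \<omega> - (\<Sum>j\<in>J. x j * y j))) \<partial>coins)
      \<le> exp (128 * t\<^sup>2 * real n)"
proof (induction n)
  case 0
  then show ?case by (simp add: coins.prob_space[unfolded space_coins])
next
  case (Suc n)
  let ?Z = "\<lambda>l \<omega>. sketch x l \<omega> * sketch y l \<omega> - (\<Sum>j\<in>J. x j * y j)"
  have "(\<integral>\<omega>. exp (t * (\<Sum>l<Suc n. ?Z l \<omega>)) \<partial>coins) =
      (\<integral>\<omega>. exp (t * (\<Sum>l<n. ?Z l \<omega>)) * exp (t * ?Z n \<omega>) \<partial>coins)"
    by (simp add: distrib_left exp_add)
  also have "\<dots> = (\<integral>\<omega>. exp (t * (\<Sum>l<n. ?Z l \<omega>)) \<partial>coins) * (\<integral>\<omega>. exp (t * ?Z n \<omega>) \<partial>coins)"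
  proof (rule integral_depends_on_mult[OF finite_coins finite_imageI[OF finite_J]])
    show "(\<Union>l<n. g l ` J) \<inter> g n ` J = {}" using disjoint_g[of n] Suc.prems by fastforce
    show "depends_on (\<Union>l<n. g l ` J) (\<lambda>\<omega>. exp (t * (\<Sum>l<n. ?Z l \<omega>)))"
      by (rule depends_on_comp[OF depends_on_sketch_sum])
    show "depends_on (g n ` J) (\<lambda>\<omega>. exp (t * ?Z n \<omega>))"
      by (rule depends_on_comp[OF depends_on_sketch_mult])
  qed
  also have "\<dots> \<le> exp (128 * t\<^sup>2 * real n) * exp (128 * t\<^sup>2)"
    using Suc integral_exp_sketch_mult[OF _ x y t, of n] by (intro mult_mono) auto
  also have "\<dots> = exp (128 * t\<^sup>2 * real (Suc n))" by (simp add: algebra_simps flip: exp_add)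
  finally show ?case .
qed

lemma prob_sketch_sum_ge:
  assumes x: "(\<Sum>j\<in>J. (x j)\<^sup>2) = 1" and y: "(\<Sum>j\<in>J. (y j)\<^sup>2) = 1" and e: "0 \<le> e" "e \<le> 1"
  shows "measure coins {\<omega>. (\<Sum>l<k. sketch x l \<omega> * sketch y l \<omega> - (\<Sum>j\<in>J. x j * y j)) \<ge> real k * e}
    \<le> exp (- (real k * e\<^sup>2 / 512))"
proof -
  let ?S = "\<lambda>\<omega>. \<Sum>l<k. sketch x l \<omega> * sketch y l \<omega> - (\<Sum>j\<in>J. x j * y j)"
  \<comment> \<open>The minimiser of 128 t^2 - t e, with minimum - e^2 / 512; e <= 1 keeps it below
    1/8.\<close>
  let ?t = "e / 256"
  have dep: "depends_on (\<Union>l<k. g l ` J) (\<lambda>\<omega>. f (?S \<omega>))" for f :: "real \<Rightarrow> 'b"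
    by (rule depends_on_comp[OF depends_on_sketch_sum])
  have "measure coins {\<omega>. ?S \<omega> \<ge> real k * e} \<le>
      measure coins {\<omega>\<in>space coins. exp (?t * (real k * e)) \<le> exp (?t * ?S \<omega>)}"
  proof (rule coins.finite_measure_mono)
    show "{\<omega>. ?S \<omega> \<ge> real k * e} \<subseteq> {\<omega>\<in>space coins. exp (?t * (real k * e)) \<le> exp (?t * ?S \<omega>)}"
      using e by (auto intro: mult_left_mono simp del: times_divide_eq_left)
    show "{\<omega>\<in>space coins. exp (?t * (real k * e)) \<le> exp (?t * ?S \<omega>)} \<in> sets coins"
      using sets_depends_on[OF finite_coins dep[of "\<lambda>a. exp (?t * (real k * e)) \<le> exp (?t * a)"]] by simp
  qed
  also have "\<dots> \<le> (\<integral>\<omega>. exp (?t * ?S \<omega>) \<partial>coins) / exp (?t * (real k * e))"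
    by (rule integral_Markov_inequality_measure[where A = "{}"])
      (auto intro!: integrable_depends_on[OF finite_coins dep])
  also have "\<dots> \<le> exp (128 * ?t\<^sup>2 * real k) / exp (?t * (real k * e))"
    using e by (intro divide_right_mono integral_exp_sketch_sum[OF x y]) auto
  also have "\<dots> = exp (- (real k * e\<^sup>2 / 512))"
    by (simp add: power2_eq_square field_simps flip: exp_diff)
  finally show ?thesis .
qed

text \<open>The one-sided bound is applied to \<open>x\<close> and to its negation, which flips the
  sign of every sketch and of the mean.\<close>

lemma prob_sketch_prod_unit:
  assumes k: "0 < k" and x: "(\<Sum>j\<in>J. (x j)\<^sup>2) = 1" and y: "(\<Sum>j\<in>J. (y j)\<^sup>2) = 1"
    and e: "0 \<le> e" "e \<le> 1"
  shows "measure coins {\<omega>. \<bar>sketch_prod x y \<omega> - (\<Sum>j\<in>J. x j * y j)\<bar> > e}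
    \<le> 2 * exp (- (real k * e\<^sup>2 / 512))"
proof -
  let ?A = "\<lambda>x. {\<omega>. (\<Sum>l<k. sketch x l \<omega> * sketch y l \<omega> - (\<Sum>j\<in>J. x j * y j)) \<ge> real k * e}"
  have A: "?A x \<in> sets coins" for x
    by (rule sets_depends_on[OF finite_coins]) (rule depends_on_comp[OF depends_on_sketch_sum])
  have neg: "sketch (\<lambda>j. - x j) l \<omega> = - sketch x l \<omega>" for l \<omega>
    by (simp add: sketch_def sum_negf)
  have "{\<omega>. \<bar>sketch_prod x y \<omega> - (\<Sum>j\<in>J. x j * y j)\<bar> > e} \<subseteq> ?A x \<union> ?A (\<lambda>j. - x j)"
  proof
    fix \<omega> assume *: "\<omega> \<in> {\<omega>. \<bar>sketch_prod x y \<omega> - (\<Sum>j\<in>J. x j * y j)\<bar> > e}"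
    let ?S = "\<Sum>l<k. sketch x l \<omega> * sketch y l \<omega>" and ?c = "\<Sum>j\<in>J. x j * y j"
    have "?S - real k * ?c = real k * (?S / real k - ?c)"
      using k by (simp add: right_diff_distrib)
    then have "\<bar>?S - real k * ?c\<bar> = real k * \<bar>?S / real k - ?c\<bar>"
      by (simp only: abs_mult abs_of_nat)
    then have "\<bar>?S - real k * ?c\<bar> \<ge> real k * e"
      using * k by (simp add: sketch_prod_def)
    then show "\<omega> \<in> ?A x \<union> ?A (\<lambda>j. - x j)"
      by (auto simp: neg sum_subtractf sum_negf abs_if split: if_splits)
  qed
  then have "measure coins {\<omega>. \<bar>sketch_prod x y \<omega> - (\<Sum>j\<in>J. x j * y j)\<bar> > e}
      \<le> measure coins (?A x \<union> ?A (\<lambda>j. - x j))"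
    by (rule coins.finite_measure_mono) (rule sets.Un[OF A A])
  also have "\<dots> \<le> measure coins (?A x) + measure coins (?A (\<lambda>j. - x j))"
    by (rule measure_Un_le[OF A A])
  also have "\<dots> \<le> exp (- (real k * e\<^sup>2 / 512)) + exp (- (real k * e\<^sup>2 / 512))"
    using x y e by (intro add_mono prob_sketch_sum_ge) auto
  finally show ?thesis by simp
qed

text \<open>Deviation and threshold both scale with the two norms, which reduces the claim to unit
  vectors. If a vector vanishes, so does the deviation, and the strict inequality makes the event
  empty.\<close>

theorem prob_sketch_prod:
  assumes k: "0 < k" and e: "0 \<le> e" "e \<le> 1"
  shows "measure coins {\<omega>. \<bar>sketch_prod x y \<omega> - (\<Sum>j\<in>J. x j * y j)\<bar> >
      e * sqrt (\<Sum>j\<in>J. (x j)\<^sup>2) * sqrt (\<Sum>j\<in>J. (y j)\<^sup>2)}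
    \<le> 2 * exp (- (real k * e\<^sup>2 / 512))"
proof (cases "(\<Sum>j\<in>J. (x j)\<^sup>2) = 0 \<or> (\<Sum>j\<in>J. (y j)\<^sup>2) = 0")
  case True
  then have "(\<forall>j\<in>J. x j = 0) \<or> (\<forall>j\<in>J. y j = 0)"
    using finite_J by (auto simp: sum_nonneg_eq_0_iff)
  then have "sketch_prod x y \<omega> = 0" "(\<Sum>j\<in>J. x j * y j) = 0" for \<omega>
    by (auto simp: sketch_prod_def sketch_def)
  moreover have "0 \<le> e * sqrt (\<Sum>j\<in>J. (x j)\<^sup>2) * sqrt (\<Sum>j\<in>J. (y j)\<^sup>2)"
    using e by (simp add: sum_nonneg)
  ultimately show ?thesis by (simp add: not_less[symmetric])
next
  case False
  define a where "a = sqrt (\<Sum>j\<in>J. (x j)\<^sup>2)"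
  define b where "b = sqrt (\<Sum>j\<in>J. (y j)\<^sup>2)"
  have nn: "(\<Sum>j\<in>J. (z j)\<^sup>2) \<ge> 0" for z :: "'a \<Rightarrow> real" by (simp add: sum_nonneg)
  have pos: "a > 0" "b > 0" using False nn[of x] nn[of y] by (simp_all add: a_def b_def)
  have sq: "a\<^sup>2 = (\<Sum>j\<in>J. (x j)\<^sup>2)" "b\<^sup>2 = (\<Sum>j\<in>J. (y j)\<^sup>2)" using nn by (simp_all add: a_def b_def)
  have scale: "sketch (\<lambda>j. z j / r) l \<omega> = sketch z l \<omega> / r" for z l \<omega> r
    by (simp add: sketch_def sum_divide_distrib)
  have eq: "{\<omega>. \<bar>sketch_prod x y \<omega> - (\<Sum>j\<in>J. x j * y j)\<bar> > e * a * b} =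
      {\<omega>. \<bar>sketch_prod (\<lambda>j. x j / a) (\<lambda>j. y j / b) \<omega> - (\<Sum>j\<in>J. x j / a * (y j / b))\<bar> > e}"
  proof (rule Collect_cong)
    fix \<omega>
    have "sketch_prod (\<lambda>j. x j / a) (\<lambda>j. y j / b) \<omega> - (\<Sum>j\<in>J. x j / a * (y j / b)) =
        (sketch_prod x y \<omega> - (\<Sum>j\<in>J. x j * y j)) / (a * b)"
      by (simp add: sketch_prod_def scale sum_divide_distrib[symmetric] diff_divide_distrib mult.commute)
    then show "\<bar>sketch_prod x y \<omega> - (\<Sum>j\<in>J. x j * y j)\<bar> > e * a * b \<longleftrightarrow>
        \<bar>sketch_prod (\<lambda>j. x j / a) (\<lambda>j. y j / b) \<omega> - (\<Sum>j\<in>J. x j / a * (y j / b))\<bar> > e"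
      using pos by (simp add: abs_mult pos_less_divide_eq mult.assoc)
  qed
  have unit: "(\<Sum>j\<in>J. (x j / a)\<^sup>2) = 1" "(\<Sum>j\<in>J. (y j / b)\<^sup>2) = 1"
    using pos by (simp_all add: power_divide sum_divide_distrib[symmetric] flip: sq)
  show ?thesis
    unfolding a_def[symmetric] b_def[symmetric] eq by (rule prob_sketch_prod_unit[OF k unit e])
qed

end

section \<open>Leverage scores\<close>

lemma diag_of_vec_carrier [simp]: "u \<in> carrier_vec m \<Longrightarrow> diag_of_vec u \<in> carrier_mat m m"
  by (auto simp: diag_of_vec_def mat_diag_def)

lemma gram_carrier [simp]:
  "A \<in> carrier_mat m n \<Longrightarrow> u \<in> carrier_vec m \<Longrightarrow> gram A u \<in> carrier_mat n n"
  unfolding gram_def by (intro mult_carrier_mat[of _ _ m] diag_of_vec_carrier) auto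

lemma matinv_carrier:
  assumes "M \<in> carrier_mat n n" "invertible_mat M"
  shows "matinv M \<in> carrier_mat n n"
proof -
  have "M * matinv M = 1\<^sub>m (dim_row M)" "matinv M * M = 1\<^sub>m (dim_row (matinv M))"
    using matinv_inverts[OF assms(2)] by (auto simp: inverts_mat_def)
  then have "dim_col (M * matinv M) = n" "dim_col (matinv M * M) = dim_row (matinv M)"
    using assms(1) by auto
  then show ?thesis using assms(1) by auto
qed

lemma matinv_mult:
  assumes "M \<in> carrier_mat n n" "invertible_mat M"
  shows "M * matinv M = 1\<^sub>m n" "matinv M * M = 1\<^sub>m n"
  using matinv_inverts[OF assms(2)] matinv_carrier[OF assms] assms(1)
  by (auto simp: inverts_mat_def)

lemma transpose_diag_of_vec [simp]: "(diag_of_vec u)\<^sup>T = diag_of_vec u"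
  by (rule eq_matI) (auto simp: diag_of_vec_def mat_diag_def)

lemma transpose_gram:
  assumes "A \<in> carrier_mat m n" "u \<in> carrier_vec m"
  shows "(gram A u)\<^sup>T = gram A u"
proof -
  have c: "A\<^sup>T \<in> carrier_mat n m" "diag_of_vec u \<in> carrier_mat m m" using assms by auto
  then have "(gram A u)\<^sup>T = A\<^sup>T * (A\<^sup>T * diag_of_vec u)\<^sup>T"
    unfolding gram_def using assms by (subst transpose_mult[of _ n m _ n]) auto
  also have "(A\<^sup>T * diag_of_vec u)\<^sup>T = diag_of_vec u * A"
    using c by (subst transpose_mult[of _ n m _ m]) auto
  also have "A\<^sup>T * (diag_of_vec u * A) = gram A u"
    unfolding gram_def using c assms by (intro assoc_mult_mat[symmetric]) auto
  finally show ?thesis .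
qed

lemma transpose_matinv:
  assumes M: "M \<in> carrier_mat n n" "invertible_mat M" and sym: "M\<^sup>T = M"
  shows "(matinv M)\<^sup>T = matinv M"
proof -
  let ?B = "matinv M"
  have B: "?B \<in> carrier_mat n n" by (rule matinv_carrier[OF M])
  then have BT: "?B\<^sup>T \<in> carrier_mat n n" by simp
  have "?B\<^sup>T * M = (M * ?B)\<^sup>T" using M(1) B by (subst transpose_mult[of _ n n _ n]) (auto simp: sym)
  also have "\<dots> = 1\<^sub>m n" by (simp add: matinv_mult[OF M])
  finally have BM: "?B\<^sup>T * M = 1\<^sub>m n" .
  have "?B\<^sup>T = ?B\<^sup>T * (M * ?B)" using BT by (simp add: matinv_mult[OF M])
  also have "\<dots> = (?B\<^sup>T * M) * ?B" by (rule assoc_mult_mat[OF BT M(1) B, symmetric])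
  also have "\<dots> = ?B" using B by (simp add: BM)
  finally show ?thesis .
qed

text \<open>Without the square roots of the weights, unlike the projection whose diagonal holds the
  leverage scores: in this form the matrices of two different weightings cancel against each
  other.\<close>

definition hat_matrix :: "real mat \<Rightarrow> real vec \<Rightarrow> real mat" where
  "hat_matrix A u = A * matinv (gram A u) * A\<^sup>T"

section \<open>Projection identities for one and for two weightings\<close>

context
  fixes A :: "real mat" and m n :: nat
  assumes A: "A \<in> carrier_mat m n"
begin

lemma hat_matrix_carrier:
  assumes "u \<in> carrier_vec m" "invertible_mat (gram A u)"
  shows "hat_matrix A u \<in> carrier_mat m m"
  unfolding hat_matrix_def using A matinv_carrier[OF gram_carrier[OF A assms(1)] assms(2)]
  by (intro mult_carrier_mat[of _ _ n]) auto

lemma hat_matrix_sym: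
  assumes u: "u \<in> carrier_vec m" "invertible_mat (gram A u)" and "i < m" "j < m"
  shows "hat_matrix A u $$ (i, j) = hat_matrix A u $$ (j, i)"
proof -
  let ?B = "matinv (gram A u)"
  have B: "?B \<in> carrier_mat n n" by (rule matinv_carrier[OF gram_carrier[OF A u(1)] u(2)])
  have AT: "A\<^sup>T \<in> carrier_mat n m" using A by simp
  have "(hat_matrix A u)\<^sup>T = A * (A * ?B)\<^sup>T"
    unfolding hat_matrix_def using A B AT by (subst transpose_mult[of _ m n _ m]) auto
  also have "(A * ?B)\<^sup>T = ?B * A\<^sup>T"
    using A B by (subst transpose_mult[of _ m n _ n])
      (auto simp: transpose_matinv[OF gram_carrier[OF A u(1)] u(2) transpose_gram[OF A u(1)]])
  also have "A * (?B * A\<^sup>T) = hat_matrix A u"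
    unfolding hat_matrix_def by (rule assoc_mult_mat[OF A B AT, symmetric])
  finally have "(hat_matrix A u)\<^sup>T $$ (j, i) = hat_matrix A u $$ (j, i)" by simp
  then show ?thesis using hat_matrix_carrier[OF u] assms(3,4) by auto
qed

lemma index_mult_diag_mult:
  assumes "P \<in> carrier_mat m m" "Q \<in> carrier_mat m m" "u \<in> carrier_vec m" "i < m" "k < m"
  shows "(P * diag_of_vec u * Q) $$ (i, k) = (\<Sum>j<m. u $ j * P $$ (i, j) * Q $$ (j, k))"
proof -
  have "P * diag_of_vec u = Matrix.mat m m (\<lambda>(i, j). P $$ (i, j) * u $ j)"
    unfolding diag_of_vec_def using assms by (subst mat_diag_mult_right[of _ m]) auto
  then show ?thesis
    using assms by (auto simp: scalar_prod_def lessThan_atLeast0 mult_ac intro!: sum.cong)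
qed

text \<open>The middle factors A^T, U and A form the Gram matrix, against which \<open>B\<close>
  cancels when it is its inverse. With \<open>B'\<close> left free, this covers P V P = P and P V Q
  = Q at once.\<close>

lemma hat_matrix_mult:
  assumes B: "B \<in> carrier_mat n n" and B': "B' \<in> carrier_mat n n" and u: "u \<in> carrier_vec m"
  shows "(A * B * A\<^sup>T) * diag_of_vec u * (A * B' * A\<^sup>T) = A * (B * gram A u * B') * A\<^sup>T"
proof -
  let ?D = "diag_of_vec u" and ?G = "gram A u"
  have T: "A\<^sup>T \<in> carrier_mat n m" and D: "?D \<in> carrier_mat m m" and G: "?G \<in> carrier_mat n n"
    using A u by auto
  note AB = mult_carrier_mat[OF A B] and BT = mult_carrier_mat[OF B' T] and DA = mult_carrier_mat[OF D A]
    and AB' = mult_carrier_mat[OF A B']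
  note X = mult_carrier_mat[OF AB' T] and BG = mult_carrier_mat[OF B G]
  have "(A * B * A\<^sup>T) * ?D * (A * B' * A\<^sup>T) = (A * B) * (A\<^sup>T * (?D * (A * B' * A\<^sup>T)))"
    using assoc_mult_mat[OF mult_carrier_mat[OF AB T] D X]
      assoc_mult_mat[OF AB T mult_carrier_mat[OF D X]] by simp
  also have "A\<^sup>T * (?D * (A * B' * A\<^sup>T)) = A\<^sup>T * ((?D * A) * (B' * A\<^sup>T))"
    using assoc_mult_mat[OF A B' T] assoc_mult_mat[OF D A BT] by simp
  also have "\<dots> = ?G * (B' * A\<^sup>T)"
    unfolding gram_def using assoc_mult_mat[OF T DA BT] assoc_mult_mat[OF T D A] by simp
  also have "(A * B) * (?G * (B' * A\<^sup>T)) = A * (B * ?G * (B' * A\<^sup>T))"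
    using assoc_mult_mat[OF A B mult_carrier_mat[OF G BT]] assoc_mult_mat[OF B G BT] by simp
  also have "\<dots> = A * (B * ?G * B') * A\<^sup>T"
    using assoc_mult_mat[OF BG B' T] assoc_mult_mat[OF A mult_carrier_mat[OF BG B'] T] by simp
  finally show ?thesis .
qed

lemma hat_matrix_sum_left:
  assumes u: "u \<in> carrier_vec m" "invertible_mat (gram A u)"
    and u': "u' \<in> carrier_vec m" "invertible_mat (gram A u')" and "i < m" "k < m"
  shows "(\<Sum>j<m. u $ j * hat_matrix A u $$ (i, j) * hat_matrix A u' $$ (j, k)) = hat_matrix A u' $$ (i, k)"
proof -
  have B': "matinv (gram A u') \<in> carrier_mat n n"
    by (rule matinv_carrier[OF gram_carrier[OF A u'(1)] u'(2)])
  have "hat_matrix A u * diag_of_vec u * hat_matrix A u' = hat_matrix A u'"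
    unfolding hat_matrix_def
    using hat_matrix_mult[OF matinv_carrier[OF gram_carrier[OF A u(1)] u(2)] B' u(1)]
      matinv_mult(2)[OF gram_carrier[OF A u(1)] u(2)] B' by simp
  then show ?thesis
    using index_mult_diag_mult[OF hat_matrix_carrier[OF u] hat_matrix_carrier[OF u'] u(1) assms(5,6)]
    by simp
qed

text \<open>The left identity with exchanged roles, read through the symmetry of both
  matrices.\<close>

lemma hat_matrix_sum_right:
  assumes u: "u \<in> carrier_vec m" "invertible_mat (gram A u)"
    and u': "u' \<in> carrier_vec m" "invertible_mat (gram A u')" and "i < m" "k < m"
  shows "(\<Sum>j<m. u' $ j * hat_matrix A u $$ (i, j) * hat_matrix A u' $$ (j, k)) = hat_matrix A u $$ (i, k)"
  using hat_matrix_sum_left[OF u' u assms(6,5)] hat_matrix_sym[OF u] hat_matrix_sym[OF u'] assms(5,6)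
  by (simp add: mult_ac)

lemma leverage_eq:
  assumes u: "u \<in> carrier_vec m" "invertible_mat (gram A u)" and pos: "\<forall>i<m. u $ i > 0" and i: "i < m"
  shows "leverage A u $ i = u $ i * hat_matrix A u $$ (i, i)"
proof -
  let ?R = "diag_of_vec (map_vec sqrt u)" and ?B = "matinv (gram A u)"
  have c: "A\<^sup>T \<in> carrier_mat n m" "?R \<in> carrier_mat m m" "?B \<in> carrier_mat n n"
    using A u by (auto intro!: matinv_carrier gram_carrier[OF A])
  have H: "hat_matrix A u \<in> carrier_mat m m" by (rule hat_matrix_carrier[OF u])
  have "?R * A * ?B = ?R * (A * ?B)" using A c by (intro assoc_mult_mat[of _ m m _ n _ n]) auto
  then have "?R * A * ?B * A\<^sup>T = ?R * hat_matrix A u"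
    unfolding hat_matrix_def using A c
    by (simp only:) (intro assoc_mult_mat[of _ m m _ n _ m], auto)
  then have eq: "?R * A * ?B * A\<^sup>T * ?R = ?R * hat_matrix A u * ?R" by simp
  have "?R * hat_matrix A u = Matrix.mat m m (\<lambda>(i, j). sqrt (u $ i) * hat_matrix A u $$ (i, j))"
    unfolding diag_of_vec_def using H u
    by (subst mat_diag_mult_left[of _ _ m]) (auto intro!: eq_matI)
  then have entry: "(?R * hat_matrix A u * ?R) $$ (i, i) = sqrt (u $ i) * hat_matrix A u $$ (i, i) * sqrt (u $ i)"
    using u i unfolding diag_of_vec_def by (subst mat_diag_mult_right[of _ m]) auto
  have "leverage A u $ i = unit_vec m i \<bullet> ((?R * hat_matrix A u * ?R) *\<^sub>v unit_vec m i)"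
    unfolding leverage_def Let_def using u i by (simp add: eq)
  also have "\<dots> = (?R * hat_matrix A u * ?R) $$ (i, i)"
    using i H c by (subst scalar_prod_left_unit) (auto simp: mult_mat_vec_def scalar_prod_right_unit[of _ m])
  also have "\<dots> = u $ i * hat_matrix A u $$ (i, i)"
  proof -
    have "sqrt (u $ i) * sqrt (u $ i) = u $ i" using pos i by (simp add: less_imp_le)
    then show ?thesis unfolding entry by (metis mult.assoc mult.commute)
  qed
  finally show ?thesis .
qed

text \<open>This is how the program multiplies by the hat matrix without forming it: a pass for A^T
  f, a solve, and a pass for the rows of A.\<close>

lemma row_matinv_mult:
  assumes u: "u \<in> carrier_vec m" "invertible_mat (gram A u)" and i: "i < m"
  shows "row A i \<bullet> (matinv (gram A u) *\<^sub>v (A\<^sup>T *\<^sub>v vec m f)) = (\<Sum>j<m. hat_matrix A u $$ (i, j) * f j)"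
proof -
  let ?B = "matinv (gram A u)"
  have c: "A\<^sup>T \<in> carrier_mat n m" "?B \<in> carrier_mat n n"
    using A u by (auto intro!: matinv_carrier gram_carrier[OF A])
  have "hat_matrix A u *\<^sub>v vec m f = (A * ?B) *\<^sub>v (A\<^sup>T *\<^sub>v vec m f)"
    unfolding hat_matrix_def using A c by (intro assoc_mult_mat_vec[of _ m n _ m]) auto
  also have "\<dots> = A *\<^sub>v (?B *\<^sub>v (A\<^sup>T *\<^sub>v vec m f))"
    using A c by (intro assoc_mult_mat_vec[of _ m n _ n] mult_mat_vec_carrier[of _ n m]) auto
  finally have "(hat_matrix A u *\<^sub>v vec m f) $ i = (A *\<^sub>v (?B *\<^sub>v (A\<^sup>T *\<^sub>v vec m f))) $ i" by simp
  then show ?thesis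
    using i A hat_matrix_carrier[OF u] by (simp add: scalar_prod_def lessThan_atLeast0)
qed

text \<open>Column \<open>j\<close> of A^T is zero. Zero rows therefore need no random sign.\<close>

lemma hat_matrix_zero_row:
  assumes u: "u \<in> carrier_vec m" "invertible_mat (gram A u)" and ij: "i < m" "j < m"
    and z: "\<forall>c<n. A $$ (j, c) = 0"
  shows "hat_matrix A u $$ (i, j) = 0"
proof -
  have "col A\<^sup>T j = 0\<^sub>v n" using A ij z by (intro eq_vecI) auto
  moreover have B: "matinv (gram A u) \<in> carrier_mat n n"
    by (rule matinv_carrier[OF gram_carrier[OF A u(1)] u(2)])
  have "hat_matrix A u $$ (i, j) = row (A * matinv (gram A u)) i \<bullet> col A\<^sup>T j"
    unfolding hat_matrix_def using A ij B by (intro index_mult_mat) auto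
  ultimately show ?thesis using A B ij by (simp only:) (rule scalar_prod_right_zero, auto)
qed

end

lemma matinv_diag_mult_vec:
  assumes v: "v \<in> carrier_vec m" "\<forall>i<m. v $ i > 0" and x: "x \<in> carrier_vec m"
  shows "matinv (diag_of_vec v) *\<^sub>v x = vec m (\<lambda>i. x $ i / v $ i)"
proof -
  let ?D = "diag_of_vec v" and ?E = "mat_diag m (\<lambda>i. 1 / v $ i)"
  have D: "?D \<in> carrier_mat m m" using v by simp
  have "?D * ?E = 1\<^sub>m m" "?E * ?D = 1\<^sub>m m"
    using v unfolding diag_of_vec_def carrier_vecD[OF v(1)] mat_diag_diag
    by (auto simp: mat_diag_def intro!: eq_matI)
  then have inv: "invertible_mat ?D"
    using D unfolding invertible_mat_def inverts_mat_def
    by (intro conjI exI[of _ ?E]) (auto simp: mat_diag_def)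
  define z where "z = matinv ?D *\<^sub>v x"
  have z: "z \<in> carrier_vec m" using matinv_carrier[OF D inv] x by (simp add: z_def)
  have "?D *\<^sub>v z = (?D * matinv ?D) *\<^sub>v x"
    unfolding z_def using assoc_mult_mat_vec[OF D matinv_carrier[OF D inv] x] by simp
  also have "\<dots> = x" using x by (simp add: matinv_mult[OF D inv])
  finally have Dz: "?D *\<^sub>v z = x" .
  have "v $ i * z $ i = x $ i" if "i < m" for i
  proof -
    have "(?D *\<^sub>v z) $ i = (\<Sum>j = 0..<m. (if i = j then v $ i else 0) * z $ j)"
      using that v z by (auto simp: diag_of_vec_def mat_diag_def scalar_prod_def intro!: sum.cong)
    also have "\<dots> = (\<Sum>j = 0..<m. if i = j then v $ i * z $ j else 0)"
      by (intro sum.cong) auto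
    also have "\<dots> = v $ i * z $ i" using that by simp
    finally show ?thesis by (simp add: Dz)
  qed
  then show ?thesis unfolding z_def[symmetric] using v z
    by (intro eq_vecI) (auto simp: field_simps)
qed

lemma norm2_square: "(norm2 x)\<^sup>2 = (\<Sum>i<dim_vec x. (x $ i)\<^sup>2)"
proof -
  have "x \<bullet> x = (\<Sum>i<dim_vec x. (x $ i)\<^sup>2)"
    by (simp add: scalar_prod_def power2_eq_square lessThan_atLeast0)
  then show ?thesis by (simp add: norm2_def sum_nonneg)
qed

lemma norm2_nonneg: "norm2 x \<ge> 0"
  by (simp add: norm2_def scalar_prod_def sum_nonneg)

section \<open>Factors of the change of the leverage scores\<close>

text \<open>\<open>P\<close> and \<open>Q\<close> stand for the matrices $A (A^T V A)^{-1} A^T$ and $A (A^T W A)^{-1} A^T$.\<close>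

locale hat_pair =
  fixes m :: nat and v w :: "nat \<Rightarrow> real" and P Q :: "nat \<Rightarrow> nat \<Rightarrow> real"
  assumes v_gt: "\<And>i. i < m \<Longrightarrow> v i > 0" and w_gt: "\<And>i. i < m \<Longrightarrow> w i > 0"
    and P_sym: "\<And>i j. i < m \<Longrightarrow> j < m \<Longrightarrow> P i j = P j i"
    and Q_sym: "\<And>i j. i < m \<Longrightarrow> j < m \<Longrightarrow> Q i j = Q j i"
    and PP: "\<And>i k. i < m \<Longrightarrow> k < m \<Longrightarrow> (\<Sum>j<m. v j * P i j * P j k) = P i k"
    and QQ: "\<And>i k. i < m \<Longrightarrow> k < m \<Longrightarrow> (\<Sum>j<m. w j * Q i j * Q j k) = Q i k"
    and PvQ: "\<And>i k. i < m \<Longrightarrow> k < m \<Longrightarrow> (\<Sum>j<m. v j * P i j * Q j k) = Q i k"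
    and PwQ: "\<And>i k. i < m \<Longrightarrow> k < m \<Longrightarrow> (\<Sum>j<m. w j * P i j * Q j k) = P i k"
begin

definition rel :: "nat \<Rightarrow> real" where
  "rel i = (w i - v i) / v i"

text \<open>The vector x_i, with delta_i - delta_j multiplied out. Each of the two terms is a
  quantity of \<open>i\<close> times one of \<open>j\<close> times P_ij, so two solves per sketch
  serve all rows.\<close>

definition left_factor :: "nat \<Rightarrow> nat \<Rightarrow> real" where
  "left_factor i j = ((w i - v i) * sqrt (v j) - v i * ((w j - v j) / sqrt (v j))) * P i j"

definition right_factor :: "nat \<Rightarrow> nat \<Rightarrow> real" where
  "right_factor i j = sqrt (v j) * Q i j"

text \<open>Multiplied by sqrt (v j), the coefficient becomes w_i v_j - v_i w_j. Summed against P_ij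
  Q_ji, the weight v_j yields Q_ii and the weight w_j yields P_ii.\<close>

lemma sum_factors:
  assumes i: "i < m"
  shows "(\<Sum>j<m. left_factor i j * right_factor i j) = w i * Q i i - v i * P i i"
proof -
  have "left_factor i j * right_factor i j =
      (w i - v i) * (v j * P i j * Q j i) + v i * (v j * P i j * Q j i) - v i * (w j * P i j * Q j i)"
    if j: "j < m" for j
  proof -
    have "sqrt (v j) * sqrt (v j) = v j" "sqrt (v j) \<noteq> 0" using v_gt[OF j] by auto
    moreover have "(a * s - b * (c / s)) * s = a * (s * s) - b * c" if "s \<noteq> 0" for a b c s :: real
      using that by (simp add: field_simps)
    ultimately have "((w i - v i) * sqrt (v j) - v i * ((w j - v j) / sqrt (v j))) * sqrt (v j) =
        (w i - v i) * v j - v i * (w j - v j)"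
      by simp
    moreover have "left_factor i j * right_factor i j =
        (((w i - v i) * sqrt (v j) - v i * ((w j - v j) / sqrt (v j))) * sqrt (v j)) * (P i j * Q i j)"
      unfolding left_factor_def right_factor_def by (simp only: mult_ac)
    ultimately have "left_factor i j * right_factor i j = ((w i - v i) * v j - v i * (w j - v j)) * (P i j * Q i j)"
      by (simp only:)
    then show ?thesis using Q_sym[OF i j] by (simp add: algebra_simps)
  qed
  then have "(\<Sum>j<m. left_factor i j * right_factor i j) =
    (w i - v i) * (\<Sum>j<m. v j * P i j * Q j i) + v i * (\<Sum>j<m. v j * P i j * Q j i)
      - v i * (\<Sum>j<m. w j * P i j * Q j i)"
    by (simp add: sum.distrib sum_subtractf sum_distrib_left)
  also have "\<dots> = w i * Q i i - v i * P i i"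
    unfolding PvQ[OF i i] PwQ[OF i i] by (simp add: algebra_simps)
  finally show ?thesis .
qed

lemma sum_P_square:
  assumes i: "i < m"
  shows "(\<Sum>j<m. v j * (P i j)\<^sup>2) = P i i"
proof -
  have "(\<Sum>j<m. v j * (P i j)\<^sup>2) = (\<Sum>j<m. v j * P i j * P j i)"
  proof (rule sum.cong[OF refl])
    fix j assume "j \<in> {..<m}"
    then show "v j * (P i j)\<^sup>2 = v j * P i j * P j i"
      using P_sym[OF i, of j] by (simp add: power2_eq_square)
  qed
  then show ?thesis using PP[OF i i] by simp
qed

lemma sum_Q_square:
  assumes i: "i < m"
  shows "(\<Sum>j<m. w j * (Q i j)\<^sup>2) = Q i i"
proof -
  have "(\<Sum>j<m. w j * (Q i j)\<^sup>2) = (\<Sum>j<m. w j * Q i j * Q j i)"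
  proof (rule sum.cong[OF refl])
    fix j assume "j \<in> {..<m}"
    then show "w j * (Q i j)\<^sup>2 = w j * Q i j * Q j i"
      using Q_sym[OF i, of j] by (simp add: power2_eq_square)
  qed
  then show ?thesis using QQ[OF i i] by simp
qed

text \<open>The sum equals R_i and contains the term (u_i R_i) R_i, so a positive R_i can be divided
  out.\<close>

lemma leverage_le_one:
  assumes "\<And>j. j < m \<Longrightarrow> 0 < u j" "(\<Sum>j<m. u j * (R j)\<^sup>2) = R i" "i < m"
  shows "u i * R i \<le> (1::real)"
proof -
  have "u i * (R i)\<^sup>2 \<le> (\<Sum>j<m. u j * (R j)\<^sup>2)"
    using assms(1,3) by (intro member_le_sum) (auto intro!: mult_nonneg_nonneg less_imp_le[OF assms(1)])
  then have *: "u i * R i * R i \<le> R i" using assms(2) by (simp add: power2_eq_square mult.assoc)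
  show ?thesis
  proof (cases "R i > 0")
    case True
    then show ?thesis using * by simp
  next
    case False
    then have "u i * R i \<le> 0" using assms(1)[OF assms(3)] by (simp add: mult_le_0_iff)
    then show ?thesis by simp
  qed
qed

text \<open>Each factor 10/9 pays for replacing \<open>v\<close> by \<open>w\<close>: once inside
  the sum, to reach Q W Q = Q, and once in front, to reach a leverage score.\<close>

lemma sum_right_factor_square:
  assumes i: "i < m" and close: "\<And>j. j < m \<Longrightarrow> 9 * v j \<le> 10 * w j"
  shows "v i * (\<Sum>j<m. (right_factor i j)\<^sup>2) \<le> 100 / 81"
proof -
  have sq: "(right_factor i j)\<^sup>2 = v j * (Q i j)\<^sup>2" if "j < m" for j
    using v_gt[OF that] by (simp add: right_factor_def power_mult_distrib)
  have "(\<Sum>j<m. (right_factor i j)\<^sup>2) \<le> (\<Sum>j<m. 10 / 9 * (w j * (Q i j)\<^sup>2))"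
  proof (rule sum_mono)
    fix j assume "j \<in> {..<m}"
    then have "v j \<le> 10 / 9 * w j" using close[of j] by simp
    then have "v j * (Q i j)\<^sup>2 \<le> 10 / 9 * w j * (Q i j)\<^sup>2" by (rule mult_right_mono) simp
    then show "(right_factor i j)\<^sup>2 \<le> 10 / 9 * (w j * (Q i j)\<^sup>2)"
      using sq \<open>j \<in> {..<m}\<close> by (simp add: mult.assoc)
  qed
  also have "\<dots> = 10 / 9 * Q i i" by (simp only: sum_distrib_left[symmetric] sum_Q_square[OF i])
  finally have 1: "(\<Sum>j<m. (right_factor i j)\<^sup>2) \<le> 10 / 9 * Q i i" .
  have "v i * (\<Sum>j<m. (right_factor i j)\<^sup>2) \<le> (10 / 9 * w i) * (10 / 9 * Q i i)"
    using 1 close[OF i] w_gt[OF i] by (intro mult_mono) (auto simp: sum_nonneg)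
  also have "\<dots> = 100 / 81 * (w i * Q i i)" by simp
  also have "\<dots> \<le> 100 / 81 * 1"
    using leverage_le_one[of w "Q i" i, OF w_gt sum_Q_square[OF i] i] by (intro mult_left_mono) auto
  finally show ?thesis by simp
qed

text \<open>The inequality (a - b)^2 <= 2 a^2 + 2 b^2 separates the two relative changes, and the
  symmetry of \<open>P\<close> makes both halves equal.\<close>

lemma sum_left_factor_square:
  "(\<Sum>i<m. (\<Sum>j<m. (left_factor i j)\<^sup>2) / v i) \<le> 4 * (\<Sum>i<m. (rel i)\<^sup>2)"
proof -
  have eq: "(left_factor i j)\<^sup>2 / v i = v i * v j * (rel i - rel j)\<^sup>2 * (P i j)\<^sup>2" if "i < m" "j < m" for i j
  proof -
    have s: "sqrt (v j) * sqrt (v j) = v j" "sqrt (v j) \<noteq> 0" using v_gt[OF that(2)] by auto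
    have "(w j - v j) / sqrt (v j) = sqrt (v j) * rel j"
      using s v_gt[OF that(2)] by (simp add: rel_def field_simps)
    moreover have "w i - v i = v i * rel i" using v_gt[OF that(1)] by (simp add: rel_def)
    ultimately have "left_factor i j = v i * sqrt (v j) * (rel i - rel j) * P i j"
      by (simp add: left_factor_def algebra_simps)
    then have "(left_factor i j)\<^sup>2 = v i * v i * v j * (rel i - rel j)\<^sup>2 * (P i j)\<^sup>2"
      using v_gt[OF that(2)] by (simp add: power_mult_distrib power2_eq_square[of "v i"])
    then show ?thesis using v_gt[OF that(1)] by simp
  qed
  have bound: "(\<Sum>i<m. \<Sum>j<m. v i * v j * (rel i)\<^sup>2 * (P i j)\<^sup>2) \<le> (\<Sum>i<m. (rel i)\<^sup>2)"
  proof (rule sum_mono)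
    fix i assume "i \<in> {..<m}"
    then have i: "i < m" by simp
    have "(\<Sum>j<m. v i * v j * (rel i)\<^sup>2 * (P i j)\<^sup>2) = (rel i)\<^sup>2 * (v i * (\<Sum>j<m. v j * (P i j)\<^sup>2))"
      by (simp add: sum_distrib_left mult_ac)
    also have "\<dots> \<le> (rel i)\<^sup>2 * 1"
      unfolding sum_P_square[OF i] using leverage_le_one[of v "P i" i, OF v_gt sum_P_square[OF i] i]
      by (intro mult_left_mono) auto
    finally show "(\<Sum>j<m. v i * v j * (rel i)\<^sup>2 * (P i j)\<^sup>2) \<le> (rel i)\<^sup>2" by simp
  qed
  have swap: "(\<Sum>i<m. \<Sum>j<m. v i * v j * (rel j)\<^sup>2 * (P i j)\<^sup>2) = (\<Sum>i<m. \<Sum>j<m. v i * v j * (rel i)\<^sup>2 * (P i j)\<^sup>2)"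
  proof (subst sum.swap, intro sum.cong refl)
    fix i j assume "i \<in> {..<m}" "j \<in> {..<m}"
    then have "P j i = P i j" by (intro P_sym) auto
    then show "v j * v i * (rel i)\<^sup>2 * (P j i)\<^sup>2 = v i * v j * (rel i)\<^sup>2 * (P i j)\<^sup>2" by simp
  qed
  have "(\<Sum>i<m. (\<Sum>j<m. (left_factor i j)\<^sup>2) / v i) = (\<Sum>i<m. \<Sum>j<m. v i * v j * (rel i - rel j)\<^sup>2 * (P i j)\<^sup>2)"
    by (auto simp: sum_divide_distrib eq intro!: sum.cong)
  also have "\<dots> \<le> (\<Sum>i<m. \<Sum>j<m. 2 * (v i * v j * (rel i)\<^sup>2 * (P i j)\<^sup>2) + 2 * (v i * v j * (rel j)\<^sup>2 * (P i j)\<^sup>2))"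
  proof (intro sum_mono)
    fix i j assume "i \<in> {..<m}" "j \<in> {..<m}"
    then have "0 \<le> v i * v j * (P i j)\<^sup>2" using v_gt[of i] v_gt[of j] by simp
    moreover have "(rel i - rel j)\<^sup>2 \<le> 2 * (rel i)\<^sup>2 + 2 * (rel j)\<^sup>2"
      using zero_le_power2[of "rel i + rel j"] by (simp add: power2_eq_square algebra_simps)
    ultimately have "v i * v j * (P i j)\<^sup>2 * (rel i - rel j)\<^sup>2 \<le> v i * v j * (P i j)\<^sup>2 * (2 * (rel i)\<^sup>2 + 2 * (rel j)\<^sup>2)"
      by (rule mult_left_mono[rotated])
    then show "v i * v j * (rel i - rel j)\<^sup>2 * (P i j)\<^sup>2 \<le>
        2 * (v i * v j * (rel i)\<^sup>2 * (P i j)\<^sup>2) + 2 * (v i * v j * (rel j)\<^sup>2 * (P i j)\<^sup>2)"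
      by (simp add: algebra_simps)
  qed
  also have "\<dots> = 4 * (\<Sum>i<m. \<Sum>j<m. v i * v j * (rel i)\<^sup>2 * (P i j)\<^sup>2)"
    by (simp add: sum.distrib sum_distrib_left[symmetric] swap)
  also have "\<dots> \<le> 4 * (\<Sum>i<m. (rel i)\<^sup>2)" using bound by simp
  finally show ?thesis .
qed

text \<open>The weights 1 / v_i and v_i of the two preceding bounds cancel. Rounding 100/81 up to
  9/4 makes the constant the square of 3.\<close>

lemma sum_factors_square:
  assumes close: "\<And>j. j < m \<Longrightarrow> 9 * v j \<le> 10 * w j"
  shows "(\<Sum>i<m. (\<Sum>j<m. (left_factor i j)\<^sup>2) * (\<Sum>j<m. (right_factor i j)\<^sup>2)) \<le> 9 * (\<Sum>i<m. (rel i)\<^sup>2)"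
proof -
  have "(\<Sum>i<m. (\<Sum>j<m. (left_factor i j)\<^sup>2) * (\<Sum>j<m. (right_factor i j)\<^sup>2))
      \<le> (\<Sum>i<m. 9 / 4 * ((\<Sum>j<m. (left_factor i j)\<^sup>2) / v i))"
  proof (rule sum_mono)
    fix i assume "i \<in> {..<m}"
    then have i: "i < m" by simp
    let ?L = "(\<Sum>j<m. (left_factor i j)\<^sup>2) / v i" and ?R = "v i * (\<Sum>j<m. (right_factor i j)\<^sup>2)"
    have "0 \<le> ?L" using v_gt[OF i] by (simp add: sum_nonneg)
    then have "?L * ?R \<le> ?L * (9 / 4)"
      using sum_right_factor_square[OF i close] by (intro mult_left_mono) auto
    then show "(\<Sum>j<m. (left_factor i j)\<^sup>2) * (\<Sum>j<m. (right_factor i j)\<^sup>2) \<le> 9 / 4 * ?L"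
      using v_gt[OF i] by (simp add: mult.commute)
  qed
  also have "\<dots> \<le> 9 * (\<Sum>i<m. (rel i)\<^sup>2)"
    unfolding sum_distrib_left[symmetric] using sum_left_factor_square by linarith
  finally show ?thesis .
qed

end

lemma hat_pair_hat_matrix:
  assumes "A \<in> carrier_mat m n" "v \<in> carrier_vec m" "w \<in> carrier_vec m"
    "\<forall>i<m. v $ i > 0" "\<forall>i<m. w $ i > 0" "invertible_mat (gram A v)" "invertible_mat (gram A w)"
  shows "hat_pair m (($) v) (($) w) (\<lambda>i j. hat_matrix A v $$ (i, j)) (\<lambda>i j. hat_matrix A w $$ (i, j))"
proof
  show "v $ i > 0" "w $ i > 0" if "i < m" for i using assms(4,5) that by auto
qed (fact hat_matrix_sym[OF assms(1) assms(2,6)] hat_matrix_sym[OF assms(1) assms(3,7)]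
   hat_matrix_sum_left[OF assms(1) assms(2,6) assms(2,6)] hat_matrix_sum_left[OF assms(1) assms(3,7) assms(3,7)]
   hat_matrix_sum_left[OF assms(1) assms(2,6) assms(3,7)] hat_matrix_sum_right[OF assms(1) assms(2,6) assms(3,7)])+

section \<open>The program\<close>

fun straight_run :: "(solver \<Rightarrow> real mat) \<Rightarrow> (nat \<Rightarrow> bool) \<Rightarrow> prog \<Rightarrow> ram \<Rightarrow> ram" where
  "straight_run S \<omega> (ISet a e f) s = iwrite a (ieval s e) (ieval s f) s"
| "straight_run S \<omega> (RSet a e f) s = rwrite a (ieval s e) (reval s f) s"
| "straight_run S \<omega> (Toss a e) s =
    (iwrite a (ieval s e) (of_bool (\<omega> (tossed s))) s)\<lparr>tossed := Suc (tossed s)\<rparr>"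
| "straight_run S \<omega> (Apply q a b) s = rwrite_vec b (S q *\<^sub>v rread_vec (dim_col (S q)) a s) s"
| "straight_run S \<omega> (Seq p p') s = straight_run S \<omega> p' (straight_run S \<omega> p s)"
| "straight_run S \<omega> _ s = s"

fun straight_cost :: "real \<Rightarrow> prog \<Rightarrow> real" where
  "straight_cost LO Skip = 1"
| "straight_cost LO (ISet a e f) = 1 + icost e + icost f"
| "straight_cost LO (RSet a e f) = 1 + icost e + rcost f"
| "straight_cost LO (Toss a e) = 1 + icost e"
| "straight_cost LO (Apply q a b) = LO"
| "straight_cost LO (Seq p p') = straight_cost LO p + straight_cost LO p'"
| "straight_cost LO _ = 0"

fun straight :: "prog \<Rightarrow> bool" where
  "straight (Seq p p') \<longleftrightarrow> straight p \<and> straight p'"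
| "straight (Cond b p p') \<longleftrightarrow> False"
| "straight (Loop b p) \<longleftrightarrow> False"
| "straight _ \<longleftrightarrow> True"

text \<open>Replaces the relational semantics by functions that the simplifier can evaluate; the
  cost of such code does not depend on the state.\<close>

lemma exec_straight: "straight p \<Longrightarrow> exec S LO \<omega> p s (straight_cost LO p) (straight_run S \<omega> p s)"
  by (induction p arbitrary: s)
    (simp_all only: straight.simps straight_run.simps straight_cost.simps, (blast intro: exec.intros)+)

text \<open>The body costs the same in every round, so the time is exact and not just a bound; the
  invariant is indexed by the rounds done.\<close>

lemma exec_loop:
  assumes step: "\<And>i s. i < N \<Longrightarrow> I i s \<Longrightarrow> beval s b \<and> (\<exists>s'. exec S LO \<omega> p s t s' \<and> I (Suc i) s')"
    and exit: "\<And>s. I N s \<Longrightarrow> \<not> beval s b"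
    and init: "I 0 s"
  shows "\<exists>s'. exec S LO \<omega> (Loop b p) s (real N * (bcost b + t) + bcost b) s' \<and> I N s'"
proof -
  \<comment> \<open>Here \<open>j\<close> counts the rounds that remain.\<close>
  have "\<exists>s'. exec S LO \<omega> (Loop b p) s (real j * (bcost b + t) + bcost b) s' \<and> I N s'"
    if "j \<le> N" "I (N - j) s" for j s
    using that
  proof (induction j arbitrary: s)
    case 0
    then show ?case using exit by (auto intro: LoopF)
  next
    case (Suc j)
    obtain s1 where b: "beval s b" and s1: "exec S LO \<omega> p s t s1" "I (Suc (N - Suc j)) s1"
      using step[of "N - Suc j" s] Suc.prems by auto
    obtain s2 where s2: "exec S LO \<omega> (Loop b p) s1 (real j * (bcost b + t) + bcost b) s2" "I N s2"
      using Suc.IH[of s1] Suc.prems s1 by (auto simp: Suc_diff_Suc)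
    have "exec S LO \<omega> (Loop b p) s (bcost b + t + (real j * (bcost b + t) + bcost b)) s2"
      by (rule LoopT[OF b s1(1) s2(1)])
    then show ?case using s2(2) by (auto simp: algebra_simps)
  qed
  from this[of N s] init show ?thesis by simp
qed

definition for_loop :: "nat \<Rightarrow> iexp \<Rightarrow> prog \<Rightarrow> prog" where
  "for_loop a N p = Seq (ISet a (INum 0) (INum 0))
    (Loop (ILess (IGet a (INum 0)) N) (Seq p (ISet a (INum 0) (IAdd (IGet a (INum 0)) (INum 1)))))"

text \<open>Per round, 3 plus \<open>icost e\<close> for the test and 6 for the increment; outside,
  3 for the initialisation and 3 plus \<open>icost e\<close> for the failing test.\<close>

definition for_cost :: "iexp \<Rightarrow> nat \<Rightarrow> real \<Rightarrow> real" where
  "for_cost e N t = real N * (9 + icost e + t) + 6 + icost e"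

text \<open>The bound is an expression evaluated anew at each test, so the invariant has to fix its
  value along with the counter.\<close>

lemma exec_for_loop:
  assumes counter: "\<And>i s. i \<le> N \<Longrightarrow> I i s \<Longrightarrow> imem s a 0 = i \<and> ieval s e = N"
    and step: "\<And>i s. i < N \<Longrightarrow> I i s \<Longrightarrow>
      \<exists>s'. exec S LO \<omega> p s t s' \<and> imem s' a 0 = i \<and> I (Suc i) (iwrite a 0 (Suc i) s')"
    and init: "I 0 (iwrite a 0 0 s)"
  shows "\<exists>s'. exec S LO \<omega> (for_loop a e p) s (for_cost e N t) s' \<and> I N s'"
proof -
  let ?b = "ILess (IGet a (INum 0)) e"
  let ?p = "Seq p (ISet a (INum 0) (IAdd (IGet a (INum 0)) (INum 1)))"
  have "beval s ?b \<and> (\<exists>s'. exec S LO \<omega> ?p s (t + 6) s' \<and> I (Suc i) s')" if i: "i < N" "I i s" for i s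
  proof -
    obtain s' where s': "exec S LO \<omega> p s t s'" "imem s' a 0 = i" "I (Suc i) (iwrite a 0 (Suc i) s')"
      using step[OF i] by blast
    have "exec S LO \<omega> (ISet a (INum 0) (IAdd (IGet a (INum 0)) (INum 1))) s' 6 (iwrite a 0 (Suc i) s')"
      using ISet[of S LO \<omega> a "INum 0" "IAdd (IGet a (INum 0)) (INum 1)" s'] s'(2) by simp
    then show ?thesis using Seq[OF s'(1)] s'(3) counter[of i s] i by fastforce
  qed
  moreover have "\<not> beval s ?b" if "I N s" for s using counter[OF _ that] by simp
  ultimately obtain s' where
    s': "exec S LO \<omega> (Loop ?b ?p) (iwrite a 0 0 s) (real N * (bcost ?b + (t + 6)) + bcost ?b) s'" "I N s'"
    using exec_loop[of N I ?b S LO \<omega> ?p "t + 6" "iwrite a 0 0 s"] init by blast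
  have "exec S LO \<omega> (ISet a (INum 0) (INum 0)) s 3 (iwrite a 0 0 s)"
    using ISet[of S LO \<omega> a "INum 0" "INum 0" s] by simp
  from Seq[OF this s'(1)]
  have "exec S LO \<omega> (for_loop a e p) s (3 + (real N * (bcost ?b + (t + 6)) + bcost ?b)) s'"
    unfolding for_loop_def .
  moreover have "3 + (real N * (bcost ?b + (t + 6)) + bcost ?b) = for_cost e N t"
    by (simp add: for_cost_def algebra_simps)
  ultimately show ?thesis using s'(2) by metis
qed

text \<open>
  Integer arrays: 3 power of two, 4 counter over the entries of the matrix, 5 counter over the
  sketches, 6 number of sketches, 7 logarithm, 8 random bit of each row.
  Real arrays: 5 and 6 sketched right-hand sides, 7, 8 and 9 solutions, 10 left factor of each row.
  Every pass runs over the entries and not over the rows, since zero rows may outnumber the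
  non-zero entries.
\<close>

definition "entries = IGet 0 (INum 2)"
definition "entry_row = IGet 1 (IGet 4 (INum 0))"
definition "entry_col = IGet 2 (IGet 4 (INum 0))"
definition "entry_val = RGet 0 (IGet 4 (INum 0))"
definition "entry_sign = RSub (RMul (RNat (INum 2)) (RNat (IGet 8 entry_row))) (RNat (INum 1))"
definition "entry_v = RGet 1 entry_row"
definition "entry_diff = RSub (RGet 2 entry_row) (RGet 1 entry_row)"

lemmas entry_defs = entries_def entry_row_def entry_col_def entry_val_def entry_sign_def
  entry_v_def entry_diff_def

text \<open>A coin is tossed at every entry, and a row with several entries keeps the last one. Only
  cells named by the entry list are cleared, which keeps the time independent of the
  dimensions.\<close>

definition reset_pass :: prog where
  "reset_pass = for_loop 4 entries (Seq (Toss 8 entry_row) (Seq (RSet 5 entry_col (RNat (INum 0)))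
    (Seq (RSet 6 entry_col (RNat (INum 0))) (RSet 10 entry_row (RNat (INum 0))))))"

definition add_pass :: "nat \<Rightarrow> iexp \<Rightarrow> rexp \<Rightarrow> prog" where
  "add_pass b e f = for_loop 4 entries (RSet b e (RAdd (RGet b e) f))"

text \<open>Arrays 5 and 6 receive A^T times the signs scaled by sqrt v and by (w - v) / sqrt v, and
  array 10 the sketched left factor of each row. The sketched right factor is never stored: as a sum
  over the entries of its row, it is multiplied into array 4 entry by entry.\<close>

definition sketch_step :: prog where
  "sketch_step =
    Seq reset_pass
    (Seq (add_pass 5 entry_col (RMul entry_val (RMul (RSqrt entry_v) entry_sign)))
    (Seq (add_pass 6 entry_col (RMul entry_val (RMul (RDiv entry_diff (RSqrt entry_v)) entry_sign)))
    (Seq (Seq (Apply InvV 5 7) (Seq (Apply InvV 6 8) (Apply InvW 5 9)))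
    (Seq (add_pass 10 entry_row (RMul entry_val
        (RSub (RMul entry_diff (RGet 7 entry_col)) (RMul entry_v (RGet 8 entry_col)))))
    (add_pass 4 entry_row (RDiv (RMul (RMul entry_val (RGet 9 entry_col)) (RGet 10 entry_row))
        (RNat (IGet 6 (INum 0)))))))))"

text \<open>Doubling finds the least j with m <= 2^j, and j + 1 in array 7 stands in for the
  logarithm. As a real quotient cannot be rounded, the second loop counts up to the least k with k
  \<epsilon>^2 >= D (j + 1).\<close>

definition count_sketches :: "nat \<Rightarrow> prog" where
  "count_sketches D =
    Seq (Seq (ISet 3 (INum 0) (INum 1)) (ISet 7 (INum 0) (INum 1)))
    (Seq (Loop (ILess (IGet 3 (INum 0)) (IGet 0 (INum 0)))
      (Seq (ISet 3 (INum 0) (IAdd (IGet 3 (INum 0)) (IGet 3 (INum 0))))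
        (ISet 7 (INum 0) (IAdd (IGet 7 (INum 0)) (INum 1)))))
    (Loop (RLess (RMul (RNat (IGet 6 (INum 0))) (RMul (RGet 3 (INum 0)) (RGet 3 (INum 0))))
        (RMul (RNat (INum D)) (RNat (IGet 7 (INum 0)))))
      (ISet 6 (INum 0) (IAdd (IGet 6 (INum 0)) (INum 1)))))"

definition leverage_change_prog :: "nat \<Rightarrow> prog" where
  "leverage_change_prog D = Seq (count_sketches D) (for_loop 5 (IGet 6 (INum 0)) sketch_step)"

text \<open>The evaluation hypothesis ranges over all contents \<open>R\<close> of the target array,
  so no summand depends on what was accumulated before and the final state has a closed
  form.\<close>

lemma exec_add_pass:
  fixes s :: ram and b :: nat
  defines "st \<equiv> \<lambda>i R. s\<lparr>imem := (imem s)(4 := (imem s 4)(0 := i)), rmem := (rmem s)(b := R)\<rparr>"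
  assumes N: "imem s 0 2 = N"
    and eval: "\<And>i R. i < N \<Longrightarrow> ieval (st i R) e = X i \<and> reval (st i R) f = F i"
  shows "exec S LO \<omega> (add_pass b e f) s (for_cost entries N (straight_cost LO (RSet b e (RAdd (RGet b e) f))))
    (st N (\<lambda>c. rmem s b c + (\<Sum>i<N. if X i = c then F i else 0)))"
proof -
  let ?G = "\<lambda>i. st i (\<lambda>c. rmem s b c + (\<Sum>i<i. if X i = c then F i else 0))"
  let ?p = "RSet b e (RAdd (RGet b e) f)"
  have "\<exists>s'. exec S LO \<omega> (for_loop 4 entries ?p) s (for_cost entries N (straight_cost LO ?p)) s' \<and> s' = ?G N"
  proof (rule exec_for_loop)
    fix i s' assume "i < N" and s': "s' = ?G i"
    have 1: "imem (straight_run S \<omega> ?p (?G i)) 4 0 = i"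
      by (simp add: st_def rwrite_def)
    have 2: "?G (Suc i) = iwrite 4 0 (Suc i) (straight_run S \<omega> ?p (?G i))"
      using eval[OF \<open>i < N\<close>]
      by (intro ram.equality ext) (simp_all add: st_def iwrite_def rwrite_def)
    have 3: "exec S LO \<omega> ?p (?G i) (straight_cost LO ?p) (straight_run S \<omega> ?p (?G i))"
      by (rule exec_straight) simp
    show "\<exists>s''. exec S LO \<omega> ?p s' (straight_cost LO ?p) s'' \<and> imem s'' 4 0 = i \<and>
        iwrite 4 0 (Suc i) s'' = ?G (Suc i)"
      unfolding s' using 1 2 3 by (intro exI conjI) auto
  qed (auto simp: st_def entries_def N iwrite_def intro!: ram.equality)
  then show ?thesis by (simp add: add_pass_def)
qed

text \<open>Position of the last entry of row \<open>r\<close>, whose coin survives the reset; 0 is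
  a dummy for rows without entries.\<close>

fun last_pos :: "(nat \<Rightarrow> nat) \<Rightarrow> nat \<Rightarrow> nat \<Rightarrow> nat" where
  "last_pos f 0 r = 0"
| "last_pos f (Suc i) r = (if f i = r then i else last_pos f i r)"

lemma last_pos: "r \<in> f ` {..<N} \<Longrightarrow> last_pos f N r < N \<and> f (last_pos f N r) = r"
  by (induction N) (auto simp: lessThan_Suc)

lemma exec_reset_pass:
  assumes N: "imem s 0 2 = N" and erow: "imem s 1 = erow" and ecol: "imem s 2 = ecol"
  shows "exec S LO \<omega> reset_pass s (for_cost entries N 22)
    (s\<lparr>imem := (imem s)(4 := (imem s 4)(0 := N),
          8 := (\<lambda>r. if r \<in> erow ` {..<N} then of_bool (\<omega> (tossed s + last_pos erow N r)) else imem s 8 r)),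
       rmem := (rmem s)
         (5 := (\<lambda>c. if c \<in> ecol ` {..<N} then 0 else rmem s 5 c),
          6 := (\<lambda>c. if c \<in> ecol ` {..<N} then 0 else rmem s 6 c),
          10 := (\<lambda>r. if r \<in> erow ` {..<N} then 0 else rmem s 10 r)),
       tossed := tossed s + N\<rparr>)"
proof -
  \<comment> \<open>The claimed final state, parametrised by the number of processed entries, is the
    loop invariant.\<close>
  define G where "G N = s\<lparr>imem := (imem s)(4 := (imem s 4)(0 := N),
          8 := (\<lambda>r. if r \<in> erow ` {..<N} then of_bool (\<omega> (tossed s + last_pos erow N r)) else imem s 8 r)),
       rmem := (rmem s)
         (5 := (\<lambda>c. if c \<in> ecol ` {..<N} then 0 else rmem s 5 c),
          6 := (\<lambda>c. if c \<in> ecol ` {..<N} then 0 else rmem s 6 c),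
          10 := (\<lambda>r. if r \<in> erow ` {..<N} then 0 else rmem s 10 r)),
       tossed := tossed s + N\<rparr>" for N
  let ?p = "Seq (Toss 8 entry_row) (Seq (RSet 5 entry_col (RNat (INum 0)))
    (Seq (RSet 6 entry_col (RNat (INum 0))) (RSet 10 entry_row (RNat (INum 0)))))"
  have "\<exists>s'. exec S LO \<omega> (for_loop 4 entries ?p) s (for_cost entries N 22) s' \<and> s' = G N"
  proof (rule exec_for_loop)
    fix i s' assume s': "s' = G i"
    have 1: "imem (straight_run S \<omega> ?p (G i)) 4 0 = i"
      by (simp add: G_def rwrite_def iwrite_def)
    have 2: "G (Suc i) = iwrite 4 0 (Suc i) (straight_run S \<omega> ?p (G i))"
      by (intro ram.equality ext)
        (simp_all add: G_def iwrite_def rwrite_def entry_row_def entry_col_def erow ecol lessThan_Suc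
          del: One_nat_def)
    have 3: "exec S LO \<omega> ?p (G i) 22 (straight_run S \<omega> ?p (G i))"
      using exec_straight[of ?p S LO \<omega> "G i"] by (simp add: entry_defs del: straight_run.simps)
    show "\<exists>s''. exec S LO \<omega> ?p s' 22 s'' \<and> imem s'' 4 0 = i \<and>
        iwrite 4 0 (Suc i) s'' = G (Suc i)"
      unfolding s' using 1 2 3 by (intro exI conjI) auto
  qed (auto simp: G_def entries_def N iwrite_def fun_eq_iff intro!: ram.equality)
  then show ?thesis unfolding reset_pass_def G_def by blast
qed

section \<open>One sketch as a transformation of the memory\<close>

locale sketch_machine =
  fixes S :: "solver \<Rightarrow> real mat" and LO :: real and \<omega> :: "nat \<Rightarrow> bool" and N n k :: nat
    and erow ecol :: "nat \<Rightarrow> nat" and val v w :: "nat \<Rightarrow> real"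
  assumes S: "\<And>q. S q \<in> carrier_mat n n" and ecol: "\<And>i. i < N \<Longrightarrow> ecol i < n"
begin

text \<open>Sketch \<open>l\<close> starts after \<open>l * N\<close> tosses, which gives the
  sketches disjoint blocks of coins. The last clause is there because an oracle call reads all
  \<open>n\<close> cells of array 5 or 6, while a reset clears only columns with an entry.\<close>

definition ready :: "nat \<Rightarrow> ram \<Rightarrow> bool" where
  "ready l s \<longleftrightarrow> imem s 0 2 = N \<and> imem s 1 = erow \<and> imem s 2 = ecol \<and> imem s 6 0 = k \<and>
    rmem s 0 = val \<and> rmem s 1 = v \<and> rmem s 2 = w \<and> tossed s = l * N \<and>
    (\<forall>c. c \<notin> ecol ` {..<N} \<longrightarrow> rmem s 5 c = 0 \<and> rmem s 6 c = 0)"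

definition sign :: "nat \<Rightarrow> nat \<Rightarrow> real" where
  "sign l r = coin_sign (\<omega> (l * N + last_pos erow N r))"

definition rhs :: "(nat \<Rightarrow> real) \<Rightarrow> nat \<Rightarrow> real" where
  "rhs f c = (\<Sum>i<N. if ecol i = c then val i * f (erow i) else 0)"

definition solution :: "solver \<Rightarrow> (nat \<Rightarrow> real) \<Rightarrow> nat \<Rightarrow> nat \<Rightarrow> real" where
  "solution q f l c = (S q *\<^sub>v vec n (rhs (\<lambda>r. f r * sign l r))) $ c"

definition left_sum :: "nat \<Rightarrow> nat \<Rightarrow> real" where
  "left_sum l r = (\<Sum>i<N. if erow i = r then val i *
    ((w (erow i) - v (erow i)) * solution InvV (\<lambda>r. sqrt (v r)) l (ecol i)
      - v (erow i) * solution InvV (\<lambda>r. (w r - v r) / sqrt (v r)) l (ecol i)) else 0)"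

definition contrib :: "nat \<Rightarrow> nat \<Rightarrow> real" where
  "contrib l r = (\<Sum>i<N. if erow i = r then
    val i * solution InvW (\<lambda>r. sqrt (v r)) l (ecol i) * left_sum l (erow i) / real k else 0)"

definition step_cost :: real where
  "step_cost = for_cost entries N 22 + (for_cost entries N 30 + (for_cost entries N 40 +
    (3 * LO + (for_cost entries N 37 + for_cost entries N 26))))"

lemma exec_sketch_step:
  assumes s: "ready l s"
  shows "\<exists>s'. exec S LO \<omega> sketch_step s step_cost s' \<and> ready (Suc l) s' \<and> imem s' 5 = imem s 5 \<and>
    rmem s' 4 = (\<lambda>r. rmem s 4 r + contrib l r)"
proof -
  have N: "imem s 0 2 = N" and row: "imem s 1 = erow" and col: "imem s 2 = ecol" and k: "imem s 6 0 = k"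
    and val: "rmem s 0 = val" and v: "rmem s 1 = v" and w: "rmem s 2 = w" and t: "tossed s = l * N"
    and z: "\<And>c. c \<notin> ecol ` {..<N} \<Longrightarrow> rmem s 5 c = 0" "\<And>c. c \<notin> ecol ` {..<N} \<Longrightarrow> rmem s 6 c = 0"
    using s by (auto simp: ready_def)
  note defs = entry_defs
  define bits where
    "bits = (\<lambda>r. if r \<in> erow ` {..<N} then of_bool (\<omega> (l * N + last_pos erow N r)) else imem s 8 r)"
  have bits: "2 * real (bits (erow i)) - 1 = sign l (erow i)" if "i < N" for i
    using that by (auto simp: bits_def sign_def coin_sign_def)
  \<comment> \<open>Other rows may hold stale values in array 10, but that array is read only at
    rows of entries.\<close>
  define g where "g = (\<lambda>r. if r \<in> erow ` {..<N} then 0 else rmem s 10 r)"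
  define I where "I = (imem s)(4 := (imem s 4)(0 := N), 8 := bits)"
  define R1 where "R1 = (rmem s)(5 := (\<lambda>_. 0), 6 := (\<lambda>_. 0), 10 := g)"
  have I: "I 0 2 = N" "I 1 = erow" "I 2 = ecol" "I 6 0 = k" "I 4 0 = N" "I 8 = bits" "I 5 = imem s 5"
    by (simp_all add: I_def N row[simplified] col k)
  \<comment> \<open>Each pass ends with its counter at \<open>N\<close>, so between passes the
    integer memory stays \<open>I\<close> and only the real memory evolves.\<close>
  have I4: "I(4 := (I 4)(0 := N)) = I" by (rule ext) (simp add: I_def)
  define s1 where "s1 = s\<lparr>imem := I, rmem := R1, tossed := l * N + N\<rparr>"
  have e1: "exec S LO \<omega> reset_pass s (for_cost entries N 22) s1"
  proof -
    have "(\<lambda>c. if c \<in> ecol ` {..<N} then 0 else rmem s 5 c) = (\<lambda>_. 0)"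
      "(\<lambda>c. if c \<in> ecol ` {..<N} then 0 else rmem s 6 c) = (\<lambda>_. 0)"
      using z by auto
    then show ?thesis
      using exec_reset_pass[OF N row col, of S LO \<omega>] unfolding s1_def I_def R1_def bits_def g_def t by simp
  qed
  let ?u = "rhs (\<lambda>r. sqrt (v r) * sign l r)" and ?u' = "rhs (\<lambda>r. (w r - v r) / sqrt (v r) * sign l r)"
  define R2 where "R2 = R1(5 := ?u)"
  define s2 where "s2 = s1\<lparr>rmem := R2\<rparr>"
  let ?f = "RMul entry_val (RMul (RSqrt entry_v) entry_sign)"
  have e2: "exec S LO \<omega> (add_pass 5 entry_col ?f) s1 (for_cost entries N 30) s2"
  proof -
    have "exec S LO \<omega> (add_pass 5 entry_col ?f) s1
        (for_cost entries N (straight_cost LO (RSet 5 entry_col (RAdd (RGet 5 entry_col) ?f))))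
        (s1\<lparr>imem := (imem s1)(4 := (imem s1 4)(0 := N)), rmem := (rmem s1)(5 :=
          (\<lambda>c. rmem s1 5 c + (\<Sum>i<N. if ecol i = c then val i * (sqrt (v (erow i)) * sign l (erow i)) else 0)))\<rparr>)" (is "exec _ _ _ _ _ (for_cost _ _ ?c) ?s")
      by (rule exec_add_pass)
        (simp_all add: s1_def R1_def defs I val v[simplified] bits I[simplified])
    moreover have "?s = s2"
      by (intro ram.equality ext) (simp_all add: s2_def s1_def rhs_def I4 R2_def R1_def)
    moreover have "?c = 30" by (simp add: defs)
    ultimately show ?thesis by (simp only:)
  qed
  define R3 where "R3 = R2(6 := ?u')"
  define s3 where "s3 = s1\<lparr>rmem := R3\<rparr>"
  let ?f' = "RMul entry_val (RMul (RDiv entry_diff (RSqrt entry_v)) entry_sign)"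
  have e3: "exec S LO \<omega> (add_pass 6 entry_col ?f') s2 (for_cost entries N 40) s3"
  proof -
    have "exec S LO \<omega> (add_pass 6 entry_col ?f') s2
        (for_cost entries N (straight_cost LO (RSet 6 entry_col (RAdd (RGet 6 entry_col) ?f'))))
        (s2\<lparr>imem := (imem s2)(4 := (imem s2 4)(0 := N)), rmem := (rmem s2)(6 :=
          (\<lambda>c. rmem s2 6 c + (\<Sum>i<N. if ecol i = c then
            val i * ((w (erow i) - v (erow i)) / sqrt (v (erow i)) * sign l (erow i)) else 0)))\<rparr>)" (is "exec _ _ _ _ _ (for_cost _ _ ?c) ?s")
      by (rule exec_add_pass)
        (simp_all add: s2_def s1_def R2_def R1_def defs I val v[simplified] w bits I[simplified])
    moreover have "?s = s3"
      by (intro ram.equality ext) (simp_all add: s3_def s2_def s1_def rhs_def I4 R3_def R2_def R1_def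
        del: times_divide_eq_left)
    moreover have "?c = 40" by (simp add: defs)
    ultimately show ?thesis by (simp only:)
  qed
  \<comment> \<open>The oracle overwrites the first \<open>n\<close> cells only.\<close>
  define y where "y q u old = (\<lambda>c. if c < n then (S q *\<^sub>v vec n u) $ c else old c)"
    for q and u old :: "nat \<Rightarrow> real"
  define R4 where "R4 = R3(7 := y InvV ?u (rmem s 7), 8 := y InvV ?u' (rmem s 8), 9 := y InvW ?u (rmem s 9))"
  define s4 where "s4 = s1\<lparr>rmem := R4\<rparr>"
  let ?a = "Seq (Apply InvV 5 7) (Seq (Apply InvV 6 8) (Apply InvW 5 9))"
  have dims: "dim_row (S q) = n" "dim_col (S q) = n" for q using S[of q] by auto
  have e4: "exec S LO \<omega> ?a s3 (3 * LO) s4"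
  proof -
    have "straight_run S \<omega> ?a s3 = s4"
      by (intro ram.equality ext)
        (simp_all add: s4_def s3_def s1_def R4_def R3_def R2_def R1_def y_def rwrite_vec_def rread_vec_def dims)
    then show ?thesis using exec_straight[of ?a S LO \<omega> s3] by simp
  qed
  have sol: "y q u old c = (S q *\<^sub>v vec n u) $ c" if "c < n" for q u old c
    using that by (simp add: y_def)
  define R5 where "R5 = R4(10 := (\<lambda>r. g r + left_sum l r))"
  define s5 where "s5 = s1\<lparr>rmem := R5\<rparr>"
  let ?h = "RMul entry_val (RSub (RMul entry_diff (RGet 7 entry_col)) (RMul entry_v (RGet 8 entry_col)))"
  have e5: "exec S LO \<omega> (add_pass 10 entry_row ?h) s4 (for_cost entries N 37) s5"
  proof -
    have "exec S LO \<omega> (add_pass 10 entry_row ?h) s4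
        (for_cost entries N (straight_cost LO (RSet 10 entry_row (RAdd (RGet 10 entry_row) ?h))))
        (s4\<lparr>imem := (imem s4)(4 := (imem s4 4)(0 := N)), rmem := (rmem s4)(10 :=
          (\<lambda>r. rmem s4 10 r + (\<Sum>i<N. if erow i = r then val i *
            ((w (erow i) - v (erow i)) * solution InvV (\<lambda>r. sqrt (v r)) l (ecol i)
              - v (erow i) * solution InvV (\<lambda>r. (w r - v r) / sqrt (v r)) l (ecol i)) else 0)))\<rparr>)" (is "exec _ _ _ _ _ (for_cost _ _ ?c) ?s")
      by (rule exec_add_pass)
        (simp_all add: s4_def s1_def R4_def R3_def R2_def R1_def defs I val v[simplified] w I[simplified]
          sol ecol solution_def)
    moreover have "?s = s5"
      by (intro ram.equality ext) (simp_all add: s5_def s4_def s1_def left_sum_def I4 R5_def R4_def R3_def R2_def R1_def)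
    moreover have "?c = 37" by (simp add: defs)
    ultimately show ?thesis by (simp only:)
  qed
  define R6 where "R6 = R5(4 := (\<lambda>r. rmem s 4 r + contrib l r))"
  define s6 where "s6 = s1\<lparr>rmem := R6\<rparr>"
  have g: "g (erow i) = 0" if "i < N" for i using that by (simp add: g_def)
  let ?h' = "RDiv (RMul (RMul entry_val (RGet 9 entry_col)) (RGet 10 entry_row)) (RNat (IGet 6 (INum 0)))"
  have e6: "exec S LO \<omega> (add_pass 4 entry_row ?h') s5 (for_cost entries N 26) s6"
  proof -
    have "exec S LO \<omega> (add_pass 4 entry_row ?h') s5
        (for_cost entries N (straight_cost LO (RSet 4 entry_row (RAdd (RGet 4 entry_row) ?h'))))
        (s5\<lparr>imem := (imem s5)(4 := (imem s5 4)(0 := N)), rmem := (rmem s5)(4 :=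
          (\<lambda>r. rmem s5 4 r + (\<Sum>i<N. if erow i = r then
            val i * solution InvW (\<lambda>r. sqrt (v r)) l (ecol i) * left_sum l (erow i) / real k else 0)))\<rparr>)" (is "exec _ _ _ _ _ (for_cost _ _ ?c) ?s")
      by (rule exec_add_pass)
        (simp_all add: s5_def s1_def R5_def R4_def R3_def R2_def R1_def defs I val I[simplified]
          sol ecol solution_def g)
    moreover have "?s = s6"
      by (intro ram.equality ext) (simp_all add: s6_def s5_def s1_def contrib_def I4 R6_def R5_def R4_def R3_def R2_def R1_def)
    moreover have "?c = 26" by (simp add: defs)
    ultimately show ?thesis by (simp only:)
  qed
  have "exec S LO \<omega> sketch_step s step_cost s6"
    unfolding sketch_step_def step_cost_def
    by (rule exec.Seq[OF e1 exec.Seq[OF e2 exec.Seq[OF e3 exec.Seq[OF e4 exec.Seq[OF e5 e6]]]]])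
  moreover have "rhs f c = 0" if "c \<notin> ecol ` {..<N}" for f c
    unfolding rhs_def by (rule sum.neutral) (use that in auto)
  then have "ready (Suc l) s6"
    by (simp add: ready_def s6_def s1_def I I[simplified] R6_def R5_def R4_def R3_def R2_def R1_def
        val v[simplified] w add.commute)
  moreover have "imem s6 5 = imem s 5" "rmem s6 4 = (\<lambda>r. rmem s 4 r + contrib l r)"
    by (simp_all add: s6_def s1_def I R6_def)
  ultimately show ?thesis by blast
qed

lemma exec_sketches:
  assumes s: "ready 0 s" and zero: "\<And>r. rmem s 4 r = 0"
  shows "\<exists>s'. exec S LO \<omega> (for_loop 5 (IGet 6 (INum 0)) sketch_step) s (for_cost (IGet 6 (INum 0)) k step_cost) s' \<and>
    rmem s' 4 = (\<lambda>r. \<Sum>l<k. contrib l r)"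
proof -
  let ?I = "\<lambda>l s'. ready l s' \<and> imem s' 5 0 = l \<and> rmem s' 4 = (\<lambda>r. \<Sum>l<l. contrib l r)"
  have "\<exists>s'. exec S LO \<omega> (for_loop 5 (IGet 6 (INum 0)) sketch_step) s (for_cost (IGet 6 (INum 0)) k step_cost) s'
      \<and> ?I k s'"
  proof (rule exec_for_loop[where I = ?I])
    fix l s' assume I: "?I l s'"
    then obtain s'' where s'': "exec S LO \<omega> sketch_step s' step_cost s''" "ready (Suc l) s''"
      "imem s'' 5 = imem s' 5" "rmem s'' 4 = (\<lambda>r. rmem s' 4 r + contrib l r)"
      using exec_sketch_step by blast
    have "ready (Suc l) (iwrite 5 0 (Suc l) s'')"
      using s''(2) by (simp add: ready_def iwrite_def)
    then show "\<exists>s''. exec S LO \<omega> sketch_step s' step_cost s'' \<and> imem s'' 5 0 = l \<and>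
        ?I (Suc l) (iwrite 5 0 (Suc l) s'')"
      using s'' I by (intro exI[of _ s'']) (auto simp: iwrite_def)
  next
    show "?I 0 (iwrite 5 0 0 s)" using s zero by (auto simp: ready_def iwrite_def)
  qed (auto simp: ready_def)
  then show ?thesis by blast
qed

end

text \<open>The conditions on \<open>j\<close> and \<open>k\<close> express that each is the first
  value at which its loop test fails.\<close>

lemma exec_count_sketches:
  fixes s :: ram and m D :: nat
  assumes m: "imem s 0 0 = m" and e: "rmem s 3 0 = e" and k0: "imem s 6 0 = 0"
    and j: "m \<le> 2 ^ j" "\<And>i. i < j \<Longrightarrow> 2 ^ i < m"
    and k: "real D * real (Suc j) \<le> real k * (e * e)" "\<And>i. i < k \<Longrightarrow> real i * (e * e) < real D * real (Suc j)"
  shows "exec S LO \<omega> (count_sketches D) s (6 + (real j * 18 + 5 + (real k * 22 + 16)))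
    (s\<lparr>imem := (imem s)(3 := (imem s 3)(0 := 2 ^ j), 7 := (imem s 7)(0 := Suc j), 6 := (imem s 6)(0 := k))\<rparr>)"
proof -
  define G where "G i = s\<lparr>imem := (imem s)(3 := (imem s 3)(0 := 2 ^ i), 7 := (imem s 7)(0 := Suc i))\<rparr>" for i
  define H where "H i = s\<lparr>imem := (imem s)(3 := (imem s 3)(0 := 2 ^ j), 7 := (imem s 7)(0 := Suc j),
    6 := (imem s 6)(0 := i))\<rparr>" for i
  let ?p0 = "Seq (ISet 3 (INum 0) (INum 1)) (ISet 7 (INum 0) (INum 1))"
  have 0: "exec S LO \<omega> ?p0 s 6 (G 0)"
  proof -
    have "straight_run S \<omega> ?p0 s = G 0"
      by (intro ram.equality ext) (simp_all add: G_def iwrite_def)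
    then show ?thesis using exec_straight[of ?p0 S LO \<omega> s] by simp
  qed
  let ?b1 = "ILess (IGet 3 (INum 0)) (IGet 0 (INum 0))"
  let ?p1 = "Seq (ISet 3 (INum 0) (IAdd (IGet 3 (INum 0)) (IGet 3 (INum 0))))
        (ISet 7 (INum 0) (IAdd (IGet 7 (INum 0)) (INum 1)))"
  have "\<exists>s'. exec S LO \<omega> (Loop ?b1 ?p1) (G 0) (real j * (bcost ?b1 + straight_cost LO ?p1) + bcost ?b1) s' \<and> s' = G j"
  proof (rule exec_loop[where I = "\<lambda>i s'. s' = G i"])
    fix i s' assume "i < j" and s': "s' = G i"
    have "straight_run S \<omega> ?p1 (G i) = G (Suc i)"
      by (intro ram.equality ext) (simp_all add: G_def iwrite_def)
    then have "exec S LO \<omega> ?p1 s' (straight_cost LO ?p1) (G (Suc i))"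
      using exec_straight[of ?p1 S LO \<omega> s'] s' by simp
    then show "beval s' ?b1 \<and> (\<exists>s''. exec S LO \<omega> ?p1 s' (straight_cost LO ?p1) s'' \<and> s'' = G (Suc i))"
      using j(2)[OF \<open>i < j\<close>] s' by (auto simp: G_def m)
  qed (use j(1) in \<open>auto simp: G_def m\<close>)
  then have 1: "exec S LO \<omega> (Loop ?b1 ?p1) (G 0) (real j * 18 + 5) (G j)" by simp
  let ?b2 = "RLess (RMul (RNat (IGet 6 (INum 0))) (RMul (RGet 3 (INum 0)) (RGet 3 (INum 0))))
        (RMul (RNat (INum D)) (RNat (IGet 7 (INum 0))))"
  let ?p2 = "ISet 6 (INum 0) (IAdd (IGet 6 (INum 0)) (INum 1))"
  have GH: "G j = H 0" by (intro ram.equality ext) (simp_all add: G_def H_def k0)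
  have "\<exists>s'. exec S LO \<omega> (Loop ?b2 ?p2) (H 0) (real k * (bcost ?b2 + straight_cost LO ?p2) + bcost ?b2) s' \<and> s' = H k"
  proof (rule exec_loop[where I = "\<lambda>i s'. s' = H i"])
    fix i s' assume "i < k" and s': "s' = H i"
    have "straight_run S \<omega> ?p2 (H i) = H (Suc i)"
      by (intro ram.equality ext) (simp_all add: H_def iwrite_def)
    then have "exec S LO \<omega> ?p2 s' (straight_cost LO ?p2) (H (Suc i))"
      using exec_straight[of ?p2 S LO \<omega> s'] s' by simp
    then show "beval s' ?b2 \<and> (\<exists>s''. exec S LO \<omega> ?p2 s' (straight_cost LO ?p2) s'' \<and> s'' = H (Suc i))"
      using k(2)[OF \<open>i < k\<close>] s' by (auto simp: H_def e)
  qed (use k(1) in \<open>auto simp: H_def e\<close>)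
  then have 2: "exec S LO \<omega> (Loop ?b2 ?p2) (G j) (real k * 22 + 16) (H k)" by (simp add: GH)
  show ?thesis
    unfolding count_sketches_def using exec.Seq[OF 0 exec.Seq[OF 1 2]] by (simp add: H_def)
qed

section \<open>Analysis of the program\<close>

lemma sum_entries:
  assumes A: "A \<in> carrier_mat m n" and es: "lists_nonzeros es A"
    and zero: "\<And>r c. A $$ (r, c) = 0 \<Longrightarrow> h (r, c) = (0::real)"
  shows "(\<Sum>i<length es. h (es ! i)) = (\<Sum>r<m. \<Sum>c<n. h (r, c))"
proof -
  have es: "distinct es" "set es = nonzeros A" using es by (auto simp: lists_nonzeros_def)
  have "(\<Sum>i<length es. h (es ! i)) = (\<Sum>p\<in>nonzeros A. h p)"
    using sum.reindex_bij_betw[OF bij_betw_nth[OF es(1) refl refl], of h] es(2) by simp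
  also have "\<dots> = (\<Sum>p\<in>{..<m} \<times> {..<n}. h p)"
    using A by (intro sum.mono_neutral_left) (auto simp: nonzeros_def zero)
  also have "\<dots> = (\<Sum>r<m. \<Sum>c<n. h (r, c))"
    by (simp add: sum.cartesian_product)
  finally show ?thesis .
qed

locale leverage_change =
  fixes m n :: nat and A :: "real mat" and v w :: "real vec" and es :: "(nat \<times> nat) list"
  assumes A: "A \<in> carrier_mat m n" and v: "v \<in> carrier_vec m" and w: "w \<in> carrier_vec m"
    and v_pos: "\<forall>i<m. v $ i > 0" and w_pos: "\<forall>i<m. w $ i > 0"
    and inv_v: "invertible_mat (gram A v)" and inv_w: "invertible_mat (gram A w)"
    and es: "lists_nonzeros es A"
begin

sublocale hat_pair m "($) v" "($) w" "\<lambda>i j. hat_matrix A v $$ (i, j)" "\<lambda>i j. hat_matrix A w $$ (i, j)"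
  by (rule hat_pair_hat_matrix[OF A v w v_pos w_pos inv_v inv_w])

abbreviation "N \<equiv> length es"
abbreviation "erow \<equiv> array_of (map fst es)"
abbreviation "ecol \<equiv> array_of (map snd es)"
abbreviation "val \<equiv> array_of (map (\<lambda>e. A $$ e) es)"

text \<open>The rows with a non-zero entry: they alone own a sign, and the sketches sum over
  them.\<close>

definition hit_rows :: "nat set" where
  "hit_rows = erow ` {..<N}"

definition coin_of :: "nat \<Rightarrow> nat \<Rightarrow> nat" where
  "coin_of l j = l * N + last_pos erow N j"

lemma entry [simp]:
  assumes "i < N"
  shows "erow i = fst (es ! i)" "ecol i = snd (es ! i)" "val i = A $$ (es ! i)"
  using assms by (simp_all add: array_of_def)

lemma entry_in: "i < N \<Longrightarrow> es ! i \<in> nonzeros A"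
  using es nth_mem by (auto simp: lists_nonzeros_def)

lemma entry_bounds: "i < N \<Longrightarrow> fst (es ! i) < m \<and> snd (es ! i) < n"
  using entry_in[of i] A by (auto simp: nonzeros_def)

lemma hit_rows_subset: "hit_rows \<subseteq> {..<m}"
  using entry_bounds by (auto simp: hit_rows_def)

lemma zero_row:
  assumes "j < m" "j \<notin> hit_rows"
  shows "\<forall>c<n. A $$ (j, c) = 0"
proof (intro allI impI, rule ccontr)
  fix c assume "c < n" "A $$ (j, c) \<noteq> 0"
  then have "(j, c) \<in> set es" using A assms es by (auto simp: nonzeros_def lists_nonzeros_def)
  then obtain i where "i < N" "es ! i = (j, c)" by (auto simp: in_set_conv_nth)
  then have "j = erow i" "i \<in> {..<N}" by simp_all
  then show False using assms(2) unfolding hit_rows_def by blast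
qed

lemma sum_hit_rows:
  assumes "\<And>j. j < m \<Longrightarrow> \<forall>c<n. A $$ (j, c) = 0 \<Longrightarrow> f j = (0::real)"
  shows "(\<Sum>j<m. f j) = (\<Sum>j\<in>hit_rows. f j)"
  using hit_rows_subset zero_row assms by (intro sum.mono_neutral_right) auto

lemma left_factor_zero_row: "i < m \<Longrightarrow> j < m \<Longrightarrow> \<forall>c<n. A $$ (j, c) = 0 \<Longrightarrow> left_factor i j = 0"
  using hat_matrix_zero_row[OF A v inv_v] by (simp add: left_factor_def)

lemma right_factor_zero_row: "i < m \<Longrightarrow> j < m \<Longrightarrow> \<forall>c<n. A $$ (j, c) = 0 \<Longrightarrow> right_factor i j = 0"
  using hat_matrix_zero_row[OF A w inv_w] by (simp add: right_factor_def)

text \<open>Division by \<open>N\<close> recovers the sketch from the coin, since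
  \<open>last_pos\<close> is below \<open>N\<close>; within a block the position of an entry
  determines its row.\<close>

lemma rademacher_sketches: "rademacher_sketches hit_rows coin_of k"
proof
  show "finite hit_rows" by (simp add: hit_rows_def)
  have pos: "last_pos erow N j < N" "erow (last_pos erow N j) = j" if "j \<in> hit_rows" for j
    using last_pos[of j erow N] that by (auto simp: hit_rows_def)
  show "inj_on (coin_of l) hit_rows" for l
    by (rule inj_onI) (metis pos(2) coin_of_def add_left_cancel)
  have div: "coin_of l j div N = l" if "j \<in> hit_rows" for l j
  proof -
    have "N \<noteq> 0" using pos(1)[OF that] by linarith
    from div_mult_self3[OF this, of l "last_pos erow N j"] show ?thesis
      unfolding coin_of_def div_less[OF pos(1)[OF that]] by simp
  qed
  show "coin_of l ` hit_rows \<inter> coin_of l' ` hit_rows = {}" if "l' < l" for l l'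
  proof (rule ccontr)
    assume "coin_of l ` hit_rows \<inter> coin_of l' ` hit_rows \<noteq> {}"
    then obtain i j where "i \<in> hit_rows" "j \<in> hit_rows" "coin_of l i = coin_of l' j" by fastforce
    then show False using div[of i l] div[of j l'] that by simp
  qed
qed

lemma array_of_vec: "x \<in> carrier_vec m \<Longrightarrow> i < m \<Longrightarrow> array_of (list_of_vec x) i = x $ i"
  by (auto simp: array_of_def nth_list_of_vec)

lemma sketch_machine: "sketch_machine (oracles A v w) N n ecol"
proof
  show "oracles A v w q \<in> carrier_mat n n" for q
    by (cases q) (auto simp: oracles_def intro!: matinv_carrier gram_carrier[OF A] v w inv_v inv_w)
  show "ecol i < n" if "i < N" for i using that entry_bounds by simp
qed

lemma row_sum:
  assumes "r < m"
  shows "(\<Sum>i<N. if erow i = r then val i * f (ecol i) else 0) = (\<Sum>c<n. A $$ (r, c) * f c)"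
proof -
  have "(\<Sum>i<N. if erow i = r then val i * f (ecol i) else 0) =
      (\<Sum>i<N. (\<lambda>p. if fst p = r then A $$ p * f (snd p) else 0) (es ! i))"
    by (intro sum.cong) auto
  also have "\<dots> = (\<Sum>r'<m. \<Sum>c<n. if r' = r then A $$ (r', c) * f c else 0)"
    by (subst sum_entries[OF A es]) (auto intro!: sum.cong)
  also have "\<dots> = (\<Sum>r'<m. if r' = r then \<Sum>c<n. A $$ (r', c) * f c else 0)"
    by (intro sum.cong) auto
  also have "\<dots> = (\<Sum>c<n. A $$ (r, c) * f c)" using assms by simp
  finally show ?thesis .
qed

lemma col_sum:
  assumes "c < n"
  shows "(\<Sum>i<N. if ecol i = c then val i * f (erow i) else 0) = (\<Sum>r<m. A $$ (r, c) * f r)"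
proof -
  have "(\<Sum>i<N. if ecol i = c then val i * f (erow i) else 0) =
      (\<Sum>i<N. (\<lambda>p. if snd p = c then A $$ p * f (fst p) else 0) (es ! i))"
    by (intro sum.cong) auto
  also have "\<dots> = (\<Sum>r<m. \<Sum>c'<n. if c' = c then A $$ (r, c') * f r else 0)"
    by (subst sum_entries[OF A es]) (auto intro!: sum.cong)
  also have "\<dots> = (\<Sum>r<m. A $$ (r, c) * f r)" using assms by simp
  finally show ?thesis .
qed

context
  fixes \<omega> :: "nat \<Rightarrow> bool" and k :: nat
begin

interpretation mach: sketch_machine "oracles A v w" LO \<omega> N n k erow ecol val
    "array_of (list_of_vec v)" "array_of (list_of_vec w)" for LO
  by (rule sketch_machine)

interpretation rademacher_sketches hit_rows coin_of k
  by (rule rademacher_sketches)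

text \<open>Scattering over columns is multiplication by A^T and gathering along a row is
  multiplication by A, so around a solve they make up the hat matrix.\<close>

lemma row_solution:
  assumes r: "r < m" and u: "u \<in> carrier_vec m" "invertible_mat (gram A u)"
    and q: "oracles A v w q = matinv (gram A u)"
  shows "(\<Sum>c<n. A $$ (r, c) * mach.solution q f l c) = (\<Sum>j<m. hat_matrix A u $$ (r, j) * (f j * mach.sign l j))"
proof -
  have "vec n (mach.rhs (\<lambda>r. f r * mach.sign l r)) = A\<^sup>T *\<^sub>v vec m (\<lambda>r. f r * mach.sign l r)"
  proof (intro eq_vecI)
    fix c assume "c < dim_vec (A\<^sup>T *\<^sub>v vec m (\<lambda>r. f r * mach.sign l r))"
    then have c: "c < n" using A by simp
    have "mach.rhs (\<lambda>r. f r * mach.sign l r) c = (\<Sum>r<m. A $$ (r, c) * (f r * mach.sign l r))"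
      unfolding mach.rhs_def by (rule col_sum[OF c])
    then show "vec n (mach.rhs (\<lambda>r. f r * mach.sign l r)) $ c = (A\<^sup>T *\<^sub>v vec m (\<lambda>r. f r * mach.sign l r)) $ c"
      using A c by (simp add: scalar_prod_def lessThan_atLeast0)
  qed (use A in simp)
  then have sol: "mach.solution q f l c =
      (matinv (gram A u) *\<^sub>v (A\<^sup>T *\<^sub>v vec m (\<lambda>r. f r * mach.sign l r))) $ c" for c
    by (simp only: mach.solution_def q)
  have "(\<Sum>c<n. A $$ (r, c) * mach.solution q f l c) =
      row A r \<bullet> (matinv (gram A u) *\<^sub>v (A\<^sup>T *\<^sub>v vec m (\<lambda>r. f r * mach.sign l r)))"
    using r A matinv_carrier[OF gram_carrier[OF A u(1)] u(2)]
    by (simp add: sol scalar_prod_def[of "row A r"] lessThan_atLeast0)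
  then show ?thesis using row_matinv_mult[OF A u r] by simp
qed

text \<open>Linearity merges the two solves into the multiplied-out form of
  \<open>left_factor\<close>; rows without entries drop out because their columns of P
  vanish.\<close>

lemma left_sum_eq:
  assumes r: "r < m"
  shows "mach.left_sum l r = sketch (left_factor r) l \<omega>"
proof -
  let ?v = "array_of (list_of_vec v)" and ?w = "array_of (list_of_vec w)"
  let ?s1 = "mach.solution InvV (\<lambda>r. sqrt (?v r)) l" and ?s2 = "mach.solution InvV (\<lambda>r. (?w r - ?v r) / sqrt (?v r)) l"
  have q: "oracles A v w InvV = matinv (gram A v)" by (simp add: oracles_def)
  have "mach.left_sum l r = (\<Sum>i<N. if erow i = r then val i * ((?w r - ?v r) * ?s1 (ecol i) - ?v r * ?s2 (ecol i)) else 0)"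
    unfolding mach.left_sum_def by (intro sum.cong) auto
  also have "\<dots> = (\<Sum>c<n. A $$ (r, c) * ((?w r - ?v r) * ?s1 c - ?v r * ?s2 c))"
    by (rule row_sum[OF r])
  also have "\<dots> = (?w r - ?v r) * (\<Sum>c<n. A $$ (r, c) * ?s1 c) - ?v r * (\<Sum>c<n. A $$ (r, c) * ?s2 c)"
    by (simp add: right_diff_distrib sum_subtractf sum_distrib_left mult.left_commute)
  also have "\<dots> = (\<Sum>j<m. left_factor r j * mach.sign l j)"
  proof -
    have "a * (H * (p * z)) - b * (H * (d * z)) = (a * p - b * d) * H * z" for a b d p H z :: real
      by (simp add: algebra_simps)
    then show ?thesis
      unfolding row_solution[OF r v inv_v q] sum_distrib_left sum_subtractf[symmetric]
      using r v w by (intro sum.cong refl) (simp only: left_factor_def array_of_vec lessThan_iff)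
  qed
  also have "\<dots> = sketch (left_factor r) l \<omega>"
    unfolding sketch_def mach.sign_def coin_of_def
    by (rule sum_hit_rows) (simp add: left_factor_zero_row r)
  finally show ?thesis .
qed

text \<open>The left sketch is constant along row \<open>r\<close> and leaves the sum; what remains
  gathers the third solution into the right sketch.\<close>

lemma contrib_eq:
  assumes r: "r < m"
  shows "mach.contrib l r = sketch (left_factor r) l \<omega> * sketch (right_factor r) l \<omega> / real k"
proof -
  let ?s = "mach.solution InvW (\<lambda>r. sqrt (array_of (list_of_vec v) r)) l"
  have q: "oracles A v w InvW = matinv (gram A w)" by (simp add: oracles_def)
  have "mach.contrib l r = (\<Sum>i<N. if erow i = r then val i * (?s (ecol i) * mach.left_sum l r / real k) else 0)"
    unfolding mach.contrib_def by (intro sum.cong) auto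
  also have "\<dots> = (\<Sum>c<n. A $$ (r, c) * (?s c * mach.left_sum l r / real k))"
    by (rule row_sum[OF r])
  also have "\<dots> = (\<Sum>c<n. A $$ (r, c) * ?s c) * mach.left_sum l r / real k"
    by (simp add: sum_distrib_right sum_divide_distrib mult.assoc)
  also have "(\<Sum>c<n. A $$ (r, c) * ?s c) = (\<Sum>j<m. right_factor r j * mach.sign l j)"
    unfolding row_solution[OF r w inv_w q]
    using r v by (auto simp: right_factor_def array_of_vec intro!: sum.cong)
  also have "\<dots> = sketch (right_factor r) l \<omega>"
    unfolding sketch_def mach.sign_def coin_of_def
    by (rule sum_hit_rows) (simp add: right_factor_zero_row r)
  finally show ?thesis by (simp add: left_sum_eq[OF r] mult.commute)
qed

text \<open>Per sketch, an entry costs 11 for loop control in each of five passes plus 22 + 30 + 40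
  + 37 + 26 for the bodies, which is 210. The 73 consists of 22 for counting the sketch, 11 for the
  outer loop and 8 for each pass.\<close>

lemma exec_leverage_change_prog:
  assumes j: "m \<le> 2 ^ j" "\<And>i. i < j \<Longrightarrow> 2 ^ i < m"
    and k: "real D * real (Suc j) \<le> real k * (e * e)" "\<And>i. i < k \<Longrightarrow> real i * (e * e) < real D * real (Suc j)"
  shows "\<exists>s'. exec (oracles A v w) LO \<omega> (leverage_change_prog D) (input_state A es v w e)
      (35 + 18 * real j + real k * (73 + 210 * real N + 3 * LO)) s' \<and>
    rread_vec m 4 s' = vec m (\<lambda>i. sketch_prod (left_factor i) (right_factor i) \<omega>)"
proof -
  let ?s = "input_state A es v w e"
  let ?s1 = "?s\<lparr>imem := (imem ?s)(3 := (imem ?s 3)(0 := 2 ^ j), 7 := (imem ?s 7)(0 := Suc j),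
    6 := (imem ?s 6)(0 := k))\<rparr>"
  have 1: "exec (oracles A v w) LO \<omega> (count_sketches D) ?s (6 + (real j * 18 + 5 + (real k * 22 + 16))) ?s1"
    using A by (intro exec_count_sketches[OF _ _ _ j k]) (auto simp: input_state_def array_of_def)
  have "mach.ready 0 ?s1" "rmem ?s1 4 r = 0" for r
    by (simp_all add: mach.ready_def input_state_def) (simp add: array_of_def)
  then obtain s' where 2: "exec (oracles A v w) LO \<omega> (for_loop 5 (IGet 6 (INum 0)) sketch_step) ?s1
      (for_cost (IGet 6 (INum 0)) k (mach.step_cost LO)) s'" "rmem s' 4 = (\<lambda>r. \<Sum>l<k. mach.contrib l r)"
    using mach.exec_sketches[of ?s1 LO] by blast
  have "rread_vec m 4 s' = vec m (\<lambda>i. sketch_prod (left_factor i) (right_factor i) \<omega>)"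
    by (intro eq_vecI) (simp_all add: rread_vec_def 2(2) contrib_eq sketch_prod_def sum_divide_distrib)
  moreover have cost: "6 + (real j * 18 + 5 + (real k * 22 + 16)) + for_cost (IGet 6 (INum 0)) k (mach.step_cost LO)
      = 35 + 18 * real j + real k * (73 + 210 * real N + 3 * LO)"
    by (simp add: for_cost_def mach.step_cost_def entries_def algebra_simps)
  moreover note Seq[OF 1 2(1), unfolded cost, folded leverage_change_prog_def]
  ultimately show ?thesis by blast
qed

end

end

section \<open>Number of sketches, failure probability and running time\<close>

lemma obtain_least_sketch_count:
  fixes e :: real and m D :: nat
  assumes e: "0 < e" "e < 0.5" and D: "D \<ge> 1"
  obtains j k where "m \<le> 2 ^ j" "\<And>i. i < j \<Longrightarrow> 2 ^ i < m"
    "real D * real (Suc j) \<le> real k * (e * e)" "\<And>i. i < k \<Longrightarrow> real i * (e * e) < real D * real (Suc j)"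
    "0 < k" "real k \<le> 2 * real D * real (Suc j) / e\<^sup>2" "real (Suc j) \<le> real k"
proof -
  define j where "j = (LEAST j. m \<le> 2 ^ j)"
  have "m \<le> 2 ^ m" by (simp add: less_imp_le)
  then have j: "m \<le> 2 ^ j" unfolding j_def by (rule LeastI)
  have j': "2 ^ i < m" if "i < j" for i using not_less_Least[of i] that unfolding j_def by fastforce
  define k where "k = (LEAST k. real D * real (Suc j) \<le> real k * (e * e))"
  obtain k0 where "real D * real (Suc j) < real k0 * (e * e)"
    using reals_Archimedean3[of "e * e"] e by auto
  then have "real D * real (Suc j) \<le> real k0 * (e * e)" by simp
  then have k: "real D * real (Suc j) \<le> real k * (e * e)" unfolding k_def by (rule LeastI)
  have k': "real i * (e * e) < real D * real (Suc j)" if "i < k" for i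
    using not_less_Least[of i] that unfolding k_def by fastforce
  have "0 < real D * real (Suc j)" using D by simp
  then have "0 < real k * (e * e)" using k by linarith
  then have pos: "0 < k" by (cases k) auto
  have ee: "0 < e * e" "e * e \<le> 1" using e by (auto intro: mult_le_one)
  have DJ: "real (Suc j) \<le> real D * real (Suc j)" using D by simp
  have "1 \<le> real (Suc j)" by simp
  then have one: "1 \<le> real D * real (Suc j)" using DJ by (rule order_trans)
  \<comment> \<open>By minimality k - 1 still falls short; the excess e^2 is at most 1 <= D (j + 1),
    hence the factor 2.\<close>
  have "real (k - 1) * (e * e) < real D * real (Suc j)" using pos by (intro k') simp
  then have "real k * (e * e) < real D * real (Suc j) + e * e"
    using pos by (simp add: of_nat_diff algebra_simps)
  also have "\<dots> \<le> 2 * real D * real (Suc j)" using ee one by linarith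
  finally have "real k \<le> 2 * real D * real (Suc j) / e\<^sup>2"
    using ee by (simp add: pos_le_divide_eq power2_eq_square)
  \<comment> \<open>This lets the logarithm loop be charged to the sketches.\<close>
  moreover have "real (Suc j) \<le> real k"
    using DJ k mult_left_mono[OF ee(2), of "real k"] by linarith
  ultimately show thesis using that[OF j j' k k' pos] by blast
qed

text \<open>By minimality 2^(j - 1) < m for positive j, and ln 2 >= 1/2 bounds j - 1 by twice the
  logarithm. Since 1 / e > 2, the logarithm is at least 1/2 for every m, so the remaining 2 costs
  four more.\<close>

lemma log_count_bound:
  fixes e :: real and m n j :: nat
  assumes e: "0 < e" "e < 0.5" and j: "\<And>i. i < j \<Longrightarrow> 2 ^ i < m"
  shows "real (Suc j) \<le> 6 * ln (real m + real n + 1 / e)"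
proof -
  let ?X = "real m + real n + 1 / e"
  have X: "2 \<le> ?X"
  proof -
    have "2 \<le> 1 / e" using e by (simp add: field_simps)
    then show ?thesis by linarith
  qed
  have half: "1 / 2 \<le> ln (2::real)" using ln2_ge_two_thirds by simp
  moreover have ln2: "ln 2 \<le> ln ?X" using X by (subst ln_le_cancel_iff) auto
  ultimately have l: "1 / 2 \<le> ln ?X" by linarith
  show ?thesis
  proof (cases j)
    case 0
    then show ?thesis using l by simp
  next
    case (Suc i)
    have "2 ^ i < m" using j[of i] Suc by simp
    then have "(2::real) ^ i \<le> real m" by (metis less_imp_le of_nat_le_iff of_nat_numeral of_nat_power)
    also have "\<dots> \<le> ?X" using e by simp
    finally have "ln ((2::real) ^ i) \<le> ln ?X" using X by (subst ln_le_cancel_iff) auto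
    then have "real i * ln 2 \<le> ln ?X" by (simp add: ln_realpow)
    moreover have "real i * (1 / 2) \<le> real i * ln 2" using half by (intro mult_left_mono) auto
    ultimately show ?thesis using l Suc by simp
  qed
qed

text \<open>As j + 1 >= ln m, the choice of \<open>D\<close> pushes the exponential below m powr (-
  (c + 2)). One spare power of m pays for the union over the rows, the other for the factor 2 once m
  >= 2.\<close>

lemma union_bound_powr:
  fixes c e :: real and m j k D :: nat
  assumes c: "c > 0" and D: "512 * (c + 2) \<le> real D" and j: "m \<le> 2 ^ j"
    and k: "real D * real (Suc j) \<le> real k * (e * e)" and m: "m \<noteq> 1"
  shows "real m * (2 * exp (- (real k * e\<^sup>2 / 512))) \<le> real m powr (- c)"
proof (cases "m = 0")
  case False
  then have m2: "real m \<ge> 2" using m by simp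
  have "real m \<le> 2 ^ j" using j by (metis of_nat_le_iff of_nat_numeral of_nat_power)
  then have "ln (real m) \<le> ln (2 ^ j)" using m2 by (subst ln_le_cancel_iff) auto
  also have "\<dots> = real j * ln 2" by (simp add: ln_realpow)
  also have "\<dots> \<le> real (Suc j)" using ln_2_less_1 mult_left_mono[of "ln 2" 1 "real j"] by simp
  finally have "(c + 2) * ln (real m) \<le> (c + 2) * real (Suc j)" using c by (intro mult_left_mono) auto
  also have "\<dots> \<le> real k * e\<^sup>2 / 512"
    using mult_right_mono[OF D, of "real (Suc j)"] k by (simp add: power2_eq_square algebra_simps)
  finally have "exp (- (real k * e\<^sup>2 / 512)) \<le> exp (- (c + 2) * ln (real m))"
    unfolding exp_le_cancel_iff mult_minus_left by linarith
  also have "\<dots> = real m powr (- c) * real m powr (- 2)"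
    using m2 by (simp add: powr_def algebra_simps flip: exp_add)
  finally have "real m * (2 * exp (- (real k * e\<^sup>2 / 512))) \<le> real m * (2 * (real m powr (- c) * real m powr (- 2)))"
    by (intro mult_left_mono) auto
  also have "\<dots> = real m powr (- c) * (2 / real m)"
    using m2 by (simp add: powr_minus powr_numeral power2_eq_square field_simps)
  also have "\<dots> \<le> real m powr (- c) * 1" using m2 by (intro mult_left_mono) auto
  finally show ?thesis by simp
qed simp

text \<open>All is charged to k (N + LO): 35 + 18 = 53 and 73 + 210 = 283 add up to 336, and the
  bound on \<open>k\<close> brings a factor 2 times 6, giving 4032.\<close>

lemma time_bound:
  fixes X M LO e :: real and j k D N :: nat
  assumes e: "0 < e" and k: "0 < k" "real (Suc j) \<le> real k" "real k \<le> 2 * real D * real (Suc j) / e\<^sup>2"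
    and X: "real (Suc j) \<le> 6 * X" and LO: "LO \<ge> 1"
  shows "35 + 18 * real j + real k * (73 + 210 * real N + 3 * LO)
    \<le> 4032 * real D * X ^ 1 * ((real N + LO) / e\<^sup>2)"
proof -
  let ?M = "real N + LO"
  have M: "1 \<le> ?M" using LO by simp
  have kM: "real k \<le> real k * ?M" using M mult_left_mono[of 1 ?M "real k"] by simp
  have "35 + 18 * real j \<le> 53 * real k" using k(1,2) by linarith
  moreover have "real k * (73 + 210 * real N + 3 * LO) \<le> real k * (283 * ?M)"
    using LO by (intro mult_left_mono) auto
  ultimately have "35 + 18 * real j + real k * (73 + 210 * real N + 3 * LO) \<le> 336 * (real k * ?M)"
    using kM by (simp add: algebra_simps)
  also have "real k * ?M \<le> (2 * real D * (6 * X) / e\<^sup>2) * ?M"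
  proof (rule mult_right_mono)
    have "2 * real D * real (Suc j) / e\<^sup>2 \<le> 2 * real D * (6 * X) / e\<^sup>2"
      using X by (intro divide_right_mono mult_left_mono) auto
    then show "real k \<le> 2 * real D * (6 * X) / e\<^sup>2" using k(3) by linarith
  qed (use M in simp)
  finally show ?thesis by (simp add: mult_ac)
qed

section \<open>Mean and error of the estimate\<close>

context leverage_change
begin

interpretation rademacher_sketches hit_rows coin_of k for k
  by (rule rademacher_sketches)

definition estimate :: "nat \<Rightarrow> (nat \<Rightarrow> bool) \<Rightarrow> real vec" where
  "estimate k \<omega> = vec m (\<lambda>i. sketch_prod k (left_factor i) (right_factor i) \<omega>)"

lemma leverage_diff: "leverage A w - leverage A v = vec m (\<lambda>i. \<Sum>j\<in>hit_rows. left_factor i j * right_factor i j)"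
proof (rule eq_vecI)
  fix i assume "i < dim_vec (vec m (\<lambda>i. \<Sum>j\<in>hit_rows. left_factor i j * right_factor i j))"
  then have i: "i < m" by simp
  have "(\<Sum>j\<in>hit_rows. left_factor i j * right_factor i j) = (\<Sum>j<m. left_factor i j * right_factor i j)"
    by (rule sum_hit_rows[symmetric]) (simp add: left_factor_zero_row i)
  also have "\<dots> = leverage A w $ i - leverage A v $ i"
    unfolding sum_factors[OF i] leverage_eq[OF A v inv_v v_pos i] leverage_eq[OF A w inv_w w_pos i] ..
  finally show "(leverage A w - leverage A v) $ i = vec m (\<lambda>i. \<Sum>j\<in>hit_rows. left_factor i j * right_factor i j) $ i"
    using i v w by (simp add: leverage_def Let_def)
qed (use v in \<open>simp add: leverage_def Let_def\<close>)

lemma integrable_estimate: "i < m \<Longrightarrow> integrable coins (\<lambda>\<omega>. estimate k \<omega> $ i)"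
  by (simp add: estimate_def integrable_sketch_prod)

lemma integral_estimate:
  assumes "0 < k"
  shows "vec m (\<lambda>i. \<integral>\<omega>. estimate k \<omega> $ i \<partial>coins) = leverage A w - leverage A v"
  unfolding leverage_diff
  by (rule eq_vecI) (simp_all add: estimate_def integral_sketch_prod[OF assms])

lemma prob_estimate:
  fixes \<alpha> e :: real
  assumes \<alpha>: "\<alpha> = norm2 (matinv (diag_of_vec v) *\<^sub>v (v - w))" "\<alpha> \<le> 1/10"
    and e: "0 < e" "e < 0.5" and k: "0 < k"
  shows "measure coins {\<omega> \<in> space coins. norm2 (estimate k \<omega> - (leverage A w - leverage A v)) \<le> 3 * \<alpha> * e}
    \<ge> 1 - real m * (2 * exp (- (real k * e\<^sup>2 / 512)))"
proof -
  let ?d = "leverage A w - leverage A v"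
  define d where "d i = (\<Sum>j\<in>hit_rows. left_factor i j * right_factor i j)" for i
  define L where "L i = (\<Sum>j\<in>hit_rows. (left_factor i j)\<^sup>2)" for i
  define R where "R i = (\<Sum>j\<in>hit_rows. (right_factor i j)\<^sup>2)" for i
  define bad where "bad i = {\<omega>. \<bar>sketch_prod k (left_factor i) (right_factor i) \<omega> - d i\<bar> > e * sqrt (L i) * sqrt (R i)}" for i
  have nn: "0 \<le> \<alpha>" unfolding \<alpha>(1) by (rule norm2_nonneg)
  have alpha: "\<alpha>\<^sup>2 = (\<Sum>i<m. (rel i)\<^sup>2)"
  proof -
    have "matinv (diag_of_vec v) *\<^sub>v (v - w) = vec m (\<lambda>i. (v $ i - w $ i) / v $ i)"
      using matinv_diag_mult_vec[OF v v_pos, of "v - w"] v w by auto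
    then have "\<alpha>\<^sup>2 = (\<Sum>i<m. ((v $ i - w $ i) / v $ i)\<^sup>2)" by (simp add: \<alpha>(1) norm2_square)
    also have "\<dots> = (\<Sum>i<m. (rel i)\<^sup>2)"
      by (intro sum.cong refl) (simp add: rel_def power_divide power2_commute)
    finally show ?thesis .
  qed
  \<comment> \<open>The norm dominates each relative change, so w_j >= (9/10) v_j; here the
    threshold 1/10 enters.\<close>
  have close: "9 * v $ j \<le> 10 * w $ j" if j: "j < m" for j
  proof -
    have "(rel j)\<^sup>2 \<le> \<alpha>\<^sup>2" unfolding alpha using j by (intro member_le_sum) auto
    also have "\<dots> \<le> (1/10)\<^sup>2" using nn \<alpha>(2) by (intro power_mono)
    finally have "\<bar>rel j\<bar> \<le> 1/10" by (simp add: abs_le_square_iff[symmetric] del: power_one_over)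
    then have "- (1/10) \<le> rel j" by linarith
    then show ?thesis using v_gt[OF j] by (simp add: rel_def field_simps)
  qed
  have sq: "(\<Sum>i<m. L i * R i) \<le> 9 * \<alpha>\<^sup>2"
  proof -
    have "L i = (\<Sum>j<m. (left_factor i j)\<^sup>2)" "R i = (\<Sum>j<m. (right_factor i j)\<^sup>2)" if "i < m" for i
      unfolding L_def R_def
      by (auto intro!: sum_hit_rows[symmetric] simp: left_factor_zero_row right_factor_zero_row that)
    then have "(\<Sum>i<m. L i * R i) = (\<Sum>i<m. (\<Sum>j<m. (left_factor i j)\<^sup>2) * (\<Sum>j<m. (right_factor i j)\<^sup>2))"
      by (intro sum.cong) auto
    then show ?thesis using sum_factors_square[OF close] by (simp add: alpha)
  qed
  have bad: "bad i \<in> sets coins" for i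
    unfolding bad_def by (rule sets_depends_on[OF finite_coins depends_on_comp[OF depends_on_sketch_prod]])
  \<comment> \<open>Outside the bad events the squared row errors sum to at most e^2 times the sum
    of L_i R_i.\<close>
  have good: "norm2 (estimate k \<omega> - ?d) \<le> 3 * \<alpha> * e" if "\<omega> \<notin> (\<Union>i<m. bad i)" for \<omega>
  proof (rule power2_le_imp_le)
    have "(norm2 (estimate k \<omega> - ?d))\<^sup>2 = (\<Sum>i<m. (sketch_prod k (left_factor i) (right_factor i) \<omega> - d i)\<^sup>2)"
      unfolding leverage_diff norm2_square by (simp add: estimate_def d_def)
    also have "\<dots> \<le> (\<Sum>i<m. e\<^sup>2 * (L i * R i))"
    proof (rule sum_mono)
      fix i assume "i \<in> {..<m}"
      then have "\<bar>sketch_prod k (left_factor i) (right_factor i) \<omega> - d i\<bar> \<le> e * sqrt (L i) * sqrt (R i)"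
        using that by (auto simp: bad_def not_less)
      then have "(\<bar>sketch_prod k (left_factor i) (right_factor i) \<omega> - d i\<bar>)\<^sup>2 \<le> (e * sqrt (L i) * sqrt (R i))\<^sup>2"
        by (rule power_mono) simp
      also have "\<dots> = e\<^sup>2 * (L i * R i)" by (simp add: power_mult_distrib L_def R_def sum_nonneg)
      finally show "(sketch_prod k (left_factor i) (right_factor i) \<omega> - d i)\<^sup>2 \<le> e\<^sup>2 * (L i * R i)" by simp
    qed
    also have "\<dots> \<le> e\<^sup>2 * (9 * \<alpha>\<^sup>2)"
      unfolding sum_distrib_left[symmetric] using sq by (intro mult_left_mono) auto
    also have "\<dots> = (3 * \<alpha> * e)\<^sup>2" by (simp add: power_mult_distrib)
    finally show "(norm2 (estimate k \<omega> - ?d))\<^sup>2 \<le> (3 * \<alpha> * e)\<^sup>2" .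
  qed (use nn e in simp)
  have "measure coins (\<Union>i<m. bad i) \<le> (\<Sum>i<m. measure coins (bad i))"
    by (rule coins.finite_measure_subadditive_finite) (use bad in auto)
  also have "\<dots> \<le> (\<Sum>i<m. 2 * exp (- (real k * e\<^sup>2 / 512)))"
    unfolding bad_def d_def L_def R_def using e by (intro sum_mono prob_sketch_prod[OF k]) auto
  finally have union: "measure coins (\<Union>i<m. bad i) \<le> real m * (2 * exp (- (real k * e\<^sup>2 / 512)))" by simp
  have "1 - measure coins (\<Union>i<m. bad i) = measure coins (space coins - (\<Union>i<m. bad i))"
    by (rule coins.prob_compl[symmetric]) (use bad in auto)
  also have "\<dots> \<le> measure coins {\<omega> \<in> space coins. norm2 (estimate k \<omega> - ?d) \<le> 3 * \<alpha> * e}"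
  proof (rule coins.finite_measure_mono)
    have "depends_on (\<Union>l<k. coin_of l ` hit_rows) (estimate k)"
    proof (rule depends_onI)
      fix \<omega> \<omega>' :: "nat \<Rightarrow> bool" assume "\<And>j. j \<in> (\<Union>l<k. coin_of l ` hit_rows) \<Longrightarrow> \<omega> j = \<omega>' j"
      then have "sketch_prod k x y \<omega> = sketch_prod k x y \<omega>'" for x y
        by (rule depends_onD[OF depends_on_sketch_prod])
      then show "estimate k \<omega> = estimate k \<omega>'" by (simp add: estimate_def)
    qed
    then show "{\<omega> \<in> space coins. norm2 (estimate k \<omega> - ?d) \<le> 3 * \<alpha> * e} \<in> sets coins"
      using sets_depends_on[OF finite_coins depends_on_comp] by simp
  qed (use good in auto)
  finally show ?thesis using union by linarith
qed

end

theorem mainTheorem3: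
  shows "\<exists>C\<^sub>e :: real. C\<^sub>e > 0 \<and> (\<forall>c :: real. c > 0 \<longrightarrow> ( \<exists>(p :: prog) (C\<^sub>t :: real) (K :: nat).
    \<forall>(m :: nat) (n :: nat) (A :: real mat) (v :: real vec) (w :: real vec)
      (es :: (nat \<times> nat) list) (\<epsilon> :: real) (LO :: real) (\<alpha> :: real).
      A \<in> carrier_mat m n \<longrightarrow>
      v \<in> carrier_vec m \<longrightarrow> w \<in> carrier_vec m \<longrightarrow>
      (\<forall>i<m. v $ i > 0) \<longrightarrow> (\<forall>i<m. w $ i > 0) \<longrightarrow>
      \<alpha> = norm2 (matinv (diag_of_vec v) *\<^sub>v (v - w)) \<longrightarrow> \<alpha> \<le> 1/10 \<longrightarrow>
      invertible_mat (A\<^sup>T * diag_of_vec v * A) \<longrightarrow>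
      invertible_mat (A\<^sup>T * diag_of_vec w * A) \<longrightarrow>
      0 < \<epsilon> \<longrightarrow> \<epsilon> < 0.5 \<longrightarrow>
      lists_nonzeros es A \<longrightarrow> LO \<ge> 1 \<longrightarrow>
      (\<exists>h T. produces p A es v w \<epsilon> LO h T \<and>
        (\<forall>i<m. integrable coins (\<lambda>\<omega>. h \<omega> $ i)) \<and>
        vec m (\<lambda>i. \<integral>\<omega>. h \<omega> $ i \<partial>coins) = leverage A w - leverage A v \<and>
        measure coins {\<omega> \<in> space coins.
            norm2 (h \<omega> - (leverage A w - leverage A v)) \<le> C\<^sub>e * \<alpha> * \<epsilon>}
          \<ge> 1 - real m powr (- c) \<and>
        integrable coins T \<and>
        (\<integral>\<omega>. T \<omega> \<partial>coins)
          \<le> C\<^sub>t * (ln (real m + real n + 1 / \<epsilon>)) ^ K * ((real (nnz A) + LO) / \<epsilon>\<^sup>2))))"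
proof (intro exI[of _ "3::real"] conjI allI impI)
  fix c :: real assume c: "c > 0"
  \<comment> \<open>\<open>D\<close> carries the dependence on \<open>c\<close>: it is a literal of
    the program and a factor of the time constant, while the error constant 3 is free of it.\<close>
  define D where "D = nat \<lceil>512 * (c + 2)\<rceil>"
  have D: "512 * (c + 2) \<le> real D" unfolding D_def using c by linarith
  have "1 \<le> 512 * (c + 2)" using c by (simp add: algebra_simps)
  then have "1 \<le> real D" using D by (rule order_trans)
  then have D1: "D \<ge> 1" by simp
  show "\<exists>(p :: prog) (C\<^sub>t :: real) (K :: nat).
    \<forall>(m :: nat) (n :: nat) (A :: real mat) (v :: real vec) (w :: real vec)
      (es :: (nat \<times> nat) list) (\<epsilon> :: real) (LO :: real) (\<alpha> :: real).
      A \<in> carrier_mat m n \<longrightarrow>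
      v \<in> carrier_vec m \<longrightarrow> w \<in> carrier_vec m \<longrightarrow>
      (\<forall>i<m. v $ i > 0) \<longrightarrow> (\<forall>i<m. w $ i > 0) \<longrightarrow>
      \<alpha> = norm2 (matinv (diag_of_vec v) *\<^sub>v (v - w)) \<longrightarrow> \<alpha> \<le> 1/10 \<longrightarrow>
      invertible_mat (A\<^sup>T * diag_of_vec v * A) \<longrightarrow>
      invertible_mat (A\<^sup>T * diag_of_vec w * A) \<longrightarrow>
      0 < \<epsilon> \<longrightarrow> \<epsilon> < 0.5 \<longrightarrow>
      lists_nonzeros es A \<longrightarrow> LO \<ge> 1 \<longrightarrow>
      (\<exists>h T. produces p A es v w \<epsilon> LO h T \<and>
        (\<forall>i<m. integrable coins (\<lambda>\<omega>. h \<omega> $ i)) \<and>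
        vec m (\<lambda>i. \<integral>\<omega>. h \<omega> $ i \<partial>coins) = leverage A w - leverage A v \<and>
        measure coins {\<omega> \<in> space coins.
            norm2 (h \<omega> - (leverage A w - leverage A v)) \<le> 3 * \<alpha> * \<epsilon>}
          \<ge> 1 - real m powr (- c) \<and>
        integrable coins T \<and>
        (\<integral>\<omega>. T \<omega> \<partial>coins)
          \<le> C\<^sub>t * (ln (real m + real n + 1 / \<epsilon>)) ^ K * ((real (nnz A) + LO) / \<epsilon>\<^sup>2))"
  \<comment> \<open>One logarithm suffices: it comes from the number of sketches, each of which
    takes time linear in the entries and the oracle cost.\<close>
  proof (rule exI[of _ "leverage_change_prog D"], rule exI[of _ "4032 * real D"], rule exI[of _ 1],
      intro allI impI)
    fix m n :: nat and A :: "real mat" and v w :: "real vec" and es :: "(nat \<times> nat) list"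
      and \<epsilon> LO \<alpha> :: real
    assume A: "A \<in> carrier_mat m n" and vw: "v \<in> carrier_vec m" "w \<in> carrier_vec m"
      "\<forall>i<m. v $ i > 0" "\<forall>i<m. w $ i > 0"
      and \<alpha>: "\<alpha> = norm2 (matinv (diag_of_vec v) *\<^sub>v (v - w))" "\<alpha> \<le> 1/10"
      and inv: "invertible_mat (A\<^sup>T * diag_of_vec v * A)" "invertible_mat (A\<^sup>T * diag_of_vec w * A)"
      and \<epsilon>: "0 < \<epsilon>" "\<epsilon> < 0.5" and es: "lists_nonzeros es A" and LO: "LO \<ge> 1"
    interpret leverage_change m n A v w es
      using A vw inv es by unfold_locales (auto simp: gram_def)
    obtain j k where j: "m \<le> 2 ^ j" "\<And>i. i < j \<Longrightarrow> 2 ^ i < m"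
      and k: "real D * real (Suc j) \<le> real k * (\<epsilon> * \<epsilon>)"
        "\<And>i. i < k \<Longrightarrow> real i * (\<epsilon> * \<epsilon>) < real D * real (Suc j)"
      and k': "0 < k" "real k \<le> 2 * real D * real (Suc j) / \<epsilon>\<^sup>2" "real (Suc j) \<le> real k"
      using obtain_least_sketch_count[OF \<epsilon> D1, of m] by metis
    define T where "T = 35 + 18 * real j + real k * (73 + 210 * real (length es) + 3 * LO)"
    have "nnz A = length es"
      using es unfolding nnz_def lists_nonzeros_def by (metis distinct_card)
    then have time: "T \<le> 4032 * real D * ln (real m + real n + 1 / \<epsilon>) ^ 1 * ((real (nnz A) + LO) / \<epsilon>\<^sup>2)"
      unfolding T_def using time_bound[OF \<epsilon>(1) k'(1,3,2) log_count_bound[OF \<epsilon> j(2)] LO] by simp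
    have "produces (leverage_change_prog D) A es v w \<epsilon> LO (estimate k) (\<lambda>_. T)"
      unfolding produces_def estimate_def T_def carrier_matD(1)[OF A]
      using exec_leverage_change_prog[OF j k, of LO] by (intro AE_I2) metis
    moreover have "1 - real m powr (- c) \<le> measure coins {\<omega> \<in> space coins.
        norm2 (estimate k \<omega> - (leverage A w - leverage A v)) \<le> 3 * \<alpha> * \<epsilon>}"
    \<comment> \<open>For m = 1 the claimed probability is 1 - 1 = 0; the factor 2 of the tail bound
      would not be absorbed there.\<close>
    proof (cases "m = 1")
      case False
      then show ?thesis
        using prob_estimate[OF \<alpha> \<epsilon> k'(1)] union_bound_powr[OF c D j(1) k(1)] by linarith
    qed simp
    ultimately show "\<exists>h T. produces (leverage_change_prog D) A es v w \<epsilon> LO h T \<and>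
        (\<forall>i<m. integrable coins (\<lambda>\<omega>. h \<omega> $ i)) \<and>
        vec m (\<lambda>i. \<integral>\<omega>. h \<omega> $ i \<partial>coins) = leverage A w - leverage A v \<and>
        measure coins {\<omega> \<in> space coins.
            norm2 (h \<omega> - (leverage A w - leverage A v)) \<le> 3 * \<alpha> * \<epsilon>}
          \<ge> 1 - real m powr (- c) \<and>
        integrable coins T \<and>
        (\<integral>\<omega>. T \<omega> \<partial>coins)
          \<le> 4032 * real D * (ln (real m + real n + 1 / \<epsilon>)) ^ 1 * ((real (nnz A) + LO) / \<epsilon>\<^sup>2)"
      using integrable_estimate integral_estimate[OF k'(1)] time
      by (intro exI[of _ "estimate k"] exI[of _ "\<lambda>_. T"])
        (simp add: coins.prob_space[unfolded space_coins])
  qed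
qed simp

end
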